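(* Let $\{(X_t,Y_t),t\ge 1\}$ follow the observation-driven model $Y_t|\mathcal{F}_{t-1}\sim p(y|\eta_t)$, $X_t=g(X_{t-1},Y_{t-1})$, $X_t=B(\eta_t)=\mathrm{E}(Y_t|\mathcal{F}_{t-1})$ described in the context, and assume there are constants $a,b\ge 0$ with $a+b<1$ such that $|g(x,y)-g(x',y')|\le a|x-x'|+b|y-y'|$ for all $x,x'\ge 0$ and all $y,y'$ in $[0,\infty)$ (continuous case) or in $\mathbb{N}_0$ (integer-valued case). Then: (1) There exists a random variable $Z_\infty$ such that, for all $x\in S$, $Z_n(x)\to Z_\infty$ almost surely, where $Z_n(x)=(f_{U_1}\circ f_{U_2}\circ\cdots\circ f_{U_n})(x)$ is the backward process. The limit $Z_\infty$ does not depend on $x$ and has distribution $\pi$, which is the stationary distribution of $\{X_t\}$. (2) The Markov chain $\{X_t,t\ge 1\}$ is geometric moment contracting with $\pi$ as its unique stationary distribution. In addition, $\mathrm{E}_\pi X_1<\infty$. (3) If $\{X_t,t\ge 1\}$ starts from $\pi$, i.e., $X_1\sim\pi$, then $\{Y_t,t\ge 1\}$ is a stationary time series.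
   Context: Exponential family: $\mu$ is a $\sigma$-finite measure, and $p(y|\eta)=\exp\{\eta y-A(\eta)\}h(y)$, $y\ge 0$, is a probability density with respect to $\mu$ with natural parameter $\eta$, where $A$ and $h$ are known functions; the support is contained in $[0,\infty)$. Put $B(\eta)=A'(\eta)$. If $Y\sim p(\cdot|\eta)$ then $\mathrm{E}Y=B(\eta)$ and $\mathrm{Var}(Y)=B'(\eta)$; it is assumed that $\mathrm{Var}(Y)>0$ and $\mathrm{E}Y>0$, so $B$ is strictly increasing and positive. For $x$ in the range of $B$, $F_x$ is the cumulative distribution function of $p(\cdot|\eta)$ with $x=B(\eta)$, and $F_x^{-1}(u)=\inf\{t\ge 0:F_x(t)\ge u\}$. Model: $\mathcal{F}_0=\sigma\{\eta_1\}$, $\mathcal{F}_t=\sigma\{\eta_1,Y_1,\ldots,Y_t\}$; for $t\ge 1$ the conditional law of $Y_t$ given $\mathcal{F}_{t-1}$ has density $p(y|\eta_t)$, where $X_t=B(\eta_t)=\mathrm{E}(Y_t|\mathcal{F}_{t-1})$ evolves by $X_t=g(X_{t-1},Y_{t-1})$. Here $g$ is a non-negative function on $[0,\infty)\times[0,\infty)$ when $Y_t$ has a continuous conditional distribution, or on $[0,\infty)\times\mathbb{N}_0$, $\mathbb{N}_0=\{0,1,\ldots\}$, when $Y_t$ takes non-negative integer values. The process $\{X_t\}$ is a time-homogeneous Markov chain with state space $S\subseteq[0,\infty)$; $S$ lies in the range of $B$, is mapped into itself by the recursion, and is a complete separable metric space under $|x-x'|$. Iterated random function representation: for $u\in(0,1)$,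 $f_u(x)=g(x,F_x^{-1}(u))$; $\{U_t\}$ are iid uniform$(0,1)$. The chain started from $X_0=x$ is represented by the forward process $X_t(x)=(f_{U_t}\circ f_{U_{t-1}}\circ\cdots\circ f_{U_1})(x)$. Geometric moment contraction: a Markov chain $W_t=f_{\theta_t}(W_{t-1})$ ($\theta_t$ iid) on a complete separable metric space with metric $\rho$ and stationary distribution $\varpi$ is geometric moment contracting if, with $W_0,W_0'\sim\varpi$ independent of each other and of $\{\theta_t\}_{t\ge1}$ and $W_n(w)=f_{\theta_n}\circ\cdots\circ f_{\theta_1}(w)$, there exist $\alpha>0$, $C=C(\alpha)>0$ and $r=r(\alpha)\in(0,1)$ such that $\mathrm{E}\{\rho^\alpha(W_n(W_0),W_n(W_0'))\}\le Cr^n$ for all $n\in\mathbb{N}$. For $\{X_t\}$ the metric is $\rho(x,x')=|x-x'|$. *)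

theory Defs
  imports "HOL-Probability.Probability"
begin

(* "complete" is to mean completeness of a subset of a metric space *)
hide_const (open) Tree.complete

text \<open>
  One-parameter exponential families on the half line. The dominating measure lives on the Borel
  sets of the reals; the density vanishes for negative arguments.
\<close>

definition ef_density :: "(real \<Rightarrow> real) \<Rightarrow> (real \<Rightarrow> real) \<Rightarrow> real \<Rightarrow> real \<Rightarrow> real" where
  "ef_density A h \<eta> y = (if 0 \<le> y then exp (\<eta> * y - A \<eta>) * h y else 0)"

definition ef_law :: "real measure \<Rightarrow> (real \<Rightarrow> real) \<Rightarrow> (real \<Rightarrow> real) \<Rightarrow> real \<Rightarrow> real measure" where
  "ef_law \<mu> A h \<eta> = density \<mu> (\<lambda>y. ennreal (ef_density A h \<eta> y))"

text \<open>
  \<open>\<Theta>\<close> is the set of natural parameters. It need not be open, so at an endpoint of \<open>\<Theta>\<close> the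
  derivative \<open>B\<close> of \<open>A\<close> is one-sided. Bochner integrals of non-integrable functions are \<open>0\<close>;
  hence \<open>mean_pos\<close> and \<open>variance_pos\<close> include finiteness of the mean and of the variance.
  That \<open>B \<eta>\<close> is the mean of the law with parameter \<open>\<eta>\<close>, and that \<open>B\<close> is positive and
  strictly increasing on \<open>\<Theta>\<close>, are consequences and not assumptions.
\<close>

locale exponential_family = sigma_finite_measure \<mu> for \<mu> :: "real measure" +
  fixes A h B :: "real \<Rightarrow> real" and \<Theta> :: "real set"
  assumes sets_dominating: "sets \<mu> = sets borel"
    and parameter_interval: "is_interval \<Theta>" "interior \<Theta> \<noteq> {}"
    and h_measurable: "h \<in> borel_measurable borel"
    and h_nonneg: "\<And>y. 0 \<le> y \<Longrightarrow> 0 \<le> h y"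
    and law_prob_space: "\<And>\<eta>. \<eta> \<in> \<Theta> \<Longrightarrow> prob_space (ef_law \<mu> A h \<eta>)"
    and A_derivative: "\<And>\<eta>. \<eta> \<in> \<Theta> \<Longrightarrow> (A has_real_derivative B \<eta>) (at \<eta> within \<Theta>)"
    and mean_pos: "\<And>\<eta>. \<eta> \<in> \<Theta> \<Longrightarrow> 0 < prob_space.expectation (ef_law \<mu> A h \<eta>) (\<lambda>y. y)"
    and variance_pos: "\<And>\<eta>. \<eta> \<in> \<Theta> \<Longrightarrow> 0 < prob_space.variance (ef_law \<mu> A h \<eta>) (\<lambda>y. y)"

text \<open>The member of the family with mean \<open>x\<close>, for \<open>x \<in> B ` \<Theta>\<close> (\<open>B\<close> is injective on \<open>\<Theta>\<close>).\<close>

definition mean_law ::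
    "real measure \<Rightarrow> (real \<Rightarrow> real) \<Rightarrow> (real \<Rightarrow> real) \<Rightarrow> (real \<Rightarrow> real) \<Rightarrow> real set \<Rightarrow> real \<Rightarrow> real measure" where
  "mean_law \<mu> A h B \<Theta> x = ef_law \<mu> A h (inv_into \<Theta> B x)"

text \<open>
  The set \<open>E\<close> of possible observations, with \<open>P \<eta>\<close> the law for parameter \<open>\<eta>\<close>: the half line when
  the laws are continuous, the non-negative integers (as reals) when they are integer valued.
\<close>

definition observation_space :: "(real \<Rightarrow> real measure) \<Rightarrow> real set \<Rightarrow> real set \<Rightarrow> bool" where
  "observation_space P \<Theta> E \<longleftrightarrow>
     (E = {0..} \<and> (\<forall>\<eta>\<in>\<Theta>. continuous_on UNIV (cdf (P \<eta>)))) \<or>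
     (E = \<nat> \<and> (\<forall>\<eta>\<in>\<Theta>. AE y in P \<eta>. y \<in> \<nat>))"

definition quantile :: "real measure \<Rightarrow> real \<Rightarrow> real" where
  "quantile L u = Inf {t. 0 \<le> t \<and> u \<le> cdf L t}"

text \<open>In the following, \<open>Q x\<close> is the conditional law of the observation when the chain is at \<open>x\<close>.\<close>

definition random_map :: "(real \<Rightarrow> real measure) \<Rightarrow> (real \<Rightarrow> real \<Rightarrow> real) \<Rightarrow> real \<Rightarrow> real \<Rightarrow> real" where
  "random_map Q g u x = g x (quantile (Q x) u)"

text \<open>
  Transition kernel of the chain: the law of \<open>g x Y\<close> for \<open>Y\<close> distributed as \<open>Q x\<close>. The restriction
  to \<open>E\<close>, which carries \<open>Q x\<close>, is there because nothing is known about \<open>g x\<close> outside \<open>E\<close>.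
\<close>

definition transition_kernel ::
    "(real \<Rightarrow> real measure) \<Rightarrow> real set \<Rightarrow> (real \<Rightarrow> real \<Rightarrow> real) \<Rightarrow> real \<Rightarrow> real measure" where
  "transition_kernel Q E g x = distr (restrict_space (Q x) E) borel (g x)"

definition stationary_distribution :: "(real \<Rightarrow> real measure) \<Rightarrow> real set \<Rightarrow> real measure \<Rightarrow> bool" where
  "stationary_distribution K S \<pi> \<longleftrightarrow>
     prob_space \<pi> \<and> sets \<pi> = sets borel \<and> (AE x in \<pi>. x \<in> S) \<and>
     (\<forall>C\<in>sets borel. emeasure \<pi> C = (\<integral>\<^sup>+x. emeasure (K x) C \<partial>\<pi>))"

primrec forward :: "('t \<Rightarrow> 'x \<Rightarrow> 'x) \<Rightarrow> (nat \<Rightarrow> 't) \<Rightarrow> nat \<Rightarrow> 'x \<Rightarrow> 'x" where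
  "forward f \<theta> 0 = id"
| "forward f \<theta> (Suc n) = f (\<theta> (Suc n)) \<circ> forward f \<theta> n"

primrec backward :: "('t \<Rightarrow> 'x \<Rightarrow> 'x) \<Rightarrow> (nat \<Rightarrow> 't) \<Rightarrow> nat \<Rightarrow> 'x \<Rightarrow> 'x" where
  "backward f \<theta> 0 = id"
| "backward f \<theta> (Suc n) = backward f \<theta> n \<circ> f (\<theta> (Suc n))"

abbreviation uniform01 :: "real measure" where
  "uniform01 \<equiv> uniform_measure lborel {0<..<1}"

text \<open>
  Geometric moment contraction of the iterated random maps \<open>f\<close> driven by an iid sequence with
  law \<open>T\<close>, relative to a distribution \<open>\<pi>\<close> (which has to be stationary for the chain). Two
  independent starting points with law \<open>\<pi>\<close>, independent of the driving sequence, are realised on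
  the product space. The non-negative integral is used so that an infinite moment is not read as \<open>0\<close>.
\<close>

definition geometric_moment_contracting ::
    "'t measure \<Rightarrow> ('t \<Rightarrow> 'x::metric_space \<Rightarrow> 'x) \<Rightarrow> 'x measure \<Rightarrow> bool" where
  "geometric_moment_contracting T f \<pi> \<longleftrightarrow>
     (\<exists>\<alpha>>0. \<exists>C>0. \<exists>r. 0 < r \<and> r < 1 \<and>
       (\<forall>n. (\<integral>\<^sup>+(w, w', \<theta>). ennreal (dist (forward f \<theta> n w) (forward f \<theta> n w') powr \<alpha>)
               \<partial>(\<pi> \<Otimes>\<^sub>M (\<pi> \<Otimes>\<^sub>M (\<Pi>\<^sub>M t\<in>{1::nat..}. T))))
            \<le> ennreal (C * r ^ n)))"

text \<open>The \<open>\<sigma>\<close>-algebra generated by the initial parameter and the observations up to time \<open>t\<close>.\<close>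

definition observation_algebra ::
    "'a measure \<Rightarrow> (nat \<Rightarrow> 'a \<Rightarrow> real) \<Rightarrow> (nat \<Rightarrow> 'a \<Rightarrow> real) \<Rightarrow> nat \<Rightarrow> 'a measure" where
  "observation_algebra M \<eta> Y t = sigma (space M)
     ({\<eta> 1 -` C \<inter> space M |C. C \<in> sets borel} \<union>
      {Y s -` C \<inter> space M |s C. 1 \<le> s \<and> s \<le> t \<and> C \<in> sets borel})"

text \<open>
  The observation-driven model, for times \<open>t \<ge> 1\<close>. The mean process is \<open>B (\<eta> t \<omega>)\<close>; it takes
  values in the state space \<open>S\<close>. The conditional law of \<open>Y t\<close> given the past is \<open>P (\<eta> t)\<close>.
\<close>

definition observation_driven_model ::
    "(real \<Rightarrow> real measure) \<Rightarrow> (real \<Rightarrow> real) \<Rightarrow> real set \<Rightarrow> (real \<Rightarrow> real \<Rightarrow> real) \<Rightarrow> real set \<Rightarrow>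
     'a measure \<Rightarrow> (nat \<Rightarrow> 'a \<Rightarrow> real) \<Rightarrow> (nat \<Rightarrow> 'a \<Rightarrow> real) \<Rightarrow> bool" where
  "observation_driven_model P B \<Theta> g S M \<eta> Y \<longleftrightarrow>
     prob_space M \<and>
     (\<forall>t\<ge>1. \<eta> t \<in> borel_measurable M \<and> Y t \<in> borel_measurable M \<and>
       (\<forall>\<omega>\<in>space M. \<eta> t \<omega> \<in> \<Theta> \<and> B (\<eta> t \<omega>) \<in> S) \<and>
       (\<forall>C\<in>sets borel. AE \<omega> in M.
          real_cond_exp M (observation_algebra M \<eta> Y (t - 1)) (indicator (Y t -` C \<inter> space M)) \<omega>
            = measure (P (\<eta> t \<omega>)) C) \<and>
       (AE \<omega> in M. B (\<eta> (Suc t) \<omega>) = g (B (\<eta> t \<omega>)) (Y t \<omega>)))"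

text \<open>Strict stationarity of a time series indexed by \<open>t \<ge> 1\<close>.\<close>

definition stationary_series :: "'a measure \<Rightarrow> (nat \<Rightarrow> 'a \<Rightarrow> real) \<Rightarrow> bool" where
  "stationary_series M Y \<longleftrightarrow>
     (\<forall>J k. finite J \<and> J \<subseteq> {1..} \<longrightarrow>
        distr M (\<Pi>\<^sub>M i\<in>J. borel) (\<lambda>\<omega>. \<lambda>i\<in>J. Y (i + k) \<omega>) =
        distr M (\<Pi>\<^sub>M i\<in>J. borel) (\<lambda>\<omega>. \<lambda>i\<in>J. Y i \<omega>))"

end

theory Submission
  imports Defs
begin

text \<open>
  Write \<open>q x\<close> for the quantile function of the member of the family with mean \<open>x\<close>. Driving the chain by
  uniform variables through \<open>q\<close> couples all starting points at once, and this coupling contracts in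
  mean: since the family has an increasing likelihood ratio, \<open>q x u\<close> is increasing in \<open>x\<close> for
  each \<open>u\<close>, so \<open>E \<bar>q x U - q x' U\<bar> = \<bar>E (q x U) - E (q x' U)\<bar> = \<bar>x - x'\<bar>\<close>
  (\<open>mean_distance_q\<close>). The Lipschitz condition on \<open>g\<close> turns this into
  \<open>E \<bar>f\<^sub>U x - f\<^sub>U x'\<bar> \<le> (a + b) \<bar>x - x'\<bar>\<close> (\<open>mean_contraction_F\<close>), with \<open>a + b < 1\<close>. That the mean of the law
  with parameter \<open>\<eta>\<close> is \<open>B \<eta>\<close>, also at an endpoint of the parameter interval, is differentiation
  under the integral along one sequence (\<open>mean_eq_derivative\<close>).

  Everything else about the chain follows from contraction in mean, in the locale
  \<open>mean_contracting_maps\<close>. The map added last to the backward process acts first. Its increments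
  therefore have means bounded by a geometric sequence, so they are almost surely summable: the
  limit exists, is integrable and does not depend on the starting point
  (\<open>backward_limit_exists\<close>). Also, the law of the backward process after \<open>n\<close> steps is the \<open>n\<close>-step
  transition law, so the iterates of the transition operator applied to a bounded continuous function
  converge pointwise to its integral against the law \<open>\<pi>\<close> of the limit. The operator maps Lipschitz
  functions to Lipschitz functions, which makes \<open>\<pi>\<close> stationary; integrating the pointwise convergence
  against any other stationary law shows that it is \<open>\<pi>\<close>. Geometric moment contraction with
  exponent \<open>1\<close> is the same bound for the forward process, integrated over two starting points.

  For the observations, the conditional law assumption says that, jointly with the past, the pair
  \<open>(Y\<^sub>t, X\<^sub>t\<^sub>+\<^sub>1)\<close> is distributed as \<open>(q X\<^sub>t U, f\<^sub>U X\<^sub>t)\<close> with \<open>U\<close> uniform and independent of the past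
  (\<open>nn_integral_transition\<close>). So \<open>X\<^sub>t\<close> has law \<open>\<pi>\<close> for all \<open>t\<close> if \<open>X\<^sub>1\<close> has, and the probability of
  any event about \<open>Y\<^sub>t, \<dots>, Y\<^sub>t\<^sub>+\<^sub>n\<close> is the integral of a function of \<open>X\<^sub>t\<close> that does not involve \<open>t\<close>.
\<close>


section \<open>Exponential families\<close>

context exponential_family
begin

abbreviation law :: "real \<Rightarrow> real measure" where
  "law \<equiv> ef_law \<mu> A h"

lemma ef_density_nonneg: "0 \<le> ef_density A h \<eta> y"
  by (simp add: ef_density_def h_nonneg)

lemma ef_density_measurable [measurable]: "ef_density A h \<eta> \<in> borel_measurable borel"
proof -
  note h_measurable [measurable]
  show ?thesis unfolding ef_density_def[abs_def] by measurable
qed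

lemma borel_measurable_dominating: "borel_measurable \<mu> = borel_measurable borel"
  by (rule measurable_cong_sets) (simp_all add: sets_dominating)

lemma sets_law [simp, measurable_cong]: "sets (law \<eta>) = sets borel"
  by (simp add: ef_law_def sets_dominating)

lemma space_law [simp]: "space (law \<eta>) = UNIV"
  using sets_eq_imp_space_eq[OF sets_law] by simp

lemma AE_law_nonneg: "AE y in law \<eta>. 0 \<le> y"
  unfolding ef_law_def
proof (subst AE_density)
  show "(\<lambda>y. ennreal (ef_density A h \<eta> y)) \<in> borel_measurable \<mu>"
    unfolding borel_measurable_dominating by measurable
qed (auto simp: ef_density_def)

lemma real_distribution_law: "\<eta> \<in> \<Theta> \<Longrightarrow> real_distribution (law \<eta>)"
  unfolding real_distribution_def real_distribution_axioms_def by (simp add: law_prob_space)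

text \<open>
  Any two members of the family are mutually absolutely continuous, and the logarithm of the
  likelihood ratio is affine in the observation. All comparisons between members rest on this.
\<close>

lemma law_tilt:
  "law \<eta>' = density (law \<eta>) (\<lambda>y. ennreal (exp ((\<eta>' - \<eta>) * y - (A \<eta>' - A \<eta>))))"
proof -
  have "ef_density A h \<eta>' y = ef_density A h \<eta> y * exp ((\<eta>' - \<eta>) * y - (A \<eta>' - A \<eta>))" for y
    by (simp add: ef_density_def algebra_simps flip: exp_add)
  then have "ennreal (ef_density A h \<eta>' y) =
      ennreal (ef_density A h \<eta> y) * ennreal (exp ((\<eta>' - \<eta>) * y - (A \<eta>' - A \<eta>)))" for y
    by (simp only: ennreal_mult[OF ef_density_nonneg exp_ge_zero])
  then show ?thesis
    unfolding ef_law_def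
    by (subst density_density_eq) (simp_all add: borel_measurable_dominating)
qed

lemma integrable_tilt_iff:
  assumes [measurable]: "f \<in> borel_measurable borel"
  shows "integrable (law \<eta>') f \<longleftrightarrow> integrable (law \<eta>) (\<lambda>y. exp ((\<eta>' - \<eta>) * y) * f y)"
proof -
  have "integrable (law \<eta>') f \<longleftrightarrow>
      integrable (law \<eta>) (\<lambda>y. exp ((\<eta>' - \<eta>) * y - (A \<eta>' - A \<eta>)) * f y)"
    by (subst law_tilt[of \<eta>' \<eta>], subst integrable_density) simp_all
  also have "\<dots> \<longleftrightarrow> integrable (law \<eta>) (\<lambda>y. exp (A \<eta> - A \<eta>') * (exp ((\<eta>' - \<eta>) * y) * f y))"
    by (intro arg_cong[where f="integrable _"] ext) (simp add: algebra_simps exp_diff exp_add)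
  also have "\<dots> \<longleftrightarrow> integrable (law \<eta>) (\<lambda>y. exp ((\<eta>' - \<eta>) * y) * f y)"
    by (subst integrable_mult_left_iff) simp_all
  finally show ?thesis .
qed

lemma integral_tilt:
  assumes [measurable]: "f \<in> borel_measurable borel"
  shows "integral\<^sup>L (law \<eta>') f =
    integral\<^sup>L (law \<eta>) (\<lambda>y. exp ((\<eta>' - \<eta>) * y - (A \<eta>' - A \<eta>)) * f y)"
  by (subst law_tilt[of \<eta>' \<eta>], subst integral_density) simp_all

text \<open>
  A Bochner integral of a non-integrable function is \<open>0\<close>, so a positive mean entails integrability.
\<close>

lemma integrable_law_id: "\<eta> \<in> \<Theta> \<Longrightarrow> integrable (law \<eta>) (\<lambda>y. y)"
  using mean_pos not_integrable_integral_eq by force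

lemma law_not_degenerate:
  assumes "\<eta> \<in> \<Theta>"
  shows "\<not> (AE y in law \<eta>. y = k)"
proof
  assume ae: "AE y in law \<eta>. y = k"
  interpret prob_space "law \<eta>" using assms by (rule law_prob_space)
  have "expectation (\<lambda>y. y) = expectation (\<lambda>_. k)"
    by (rule integral_cong_AE) (use ae in auto)
  then have m: "expectation (\<lambda>y. y) = k" using prob_space by simp
  have "expectation (\<lambda>y. (y - expectation (\<lambda>y. y))\<^sup>2) = expectation (\<lambda>_. 0)"
    by (rule integral_cong_AE) (use ae m in auto)
  with variance_pos[OF assms] show False by simp
qed

text \<open>
  Integrate \<open>exp z \<ge> 1 + z\<close>, where \<open>z\<close> is the logarithm of the likelihood ratio; the left side has
  integral \<open>1\<close>. Equality would force \<open>z = 0\<close> almost surely, hence a degenerate law.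
\<close>

lemma above_tangent:
  assumes \<eta>: "\<eta> \<in> \<Theta>" and \<eta>': "\<eta>' \<in> \<Theta>" and ne: "\<eta> \<noteq> \<eta>'"
  shows "(\<eta>' - \<eta>) * integral\<^sup>L (law \<eta>) (\<lambda>y. y) < A \<eta>' - A \<eta>"
proof -
  interpret prob_space "law \<eta>" using \<eta> by (rule law_prob_space)
  interpret tilted: prob_space "law \<eta>'" using \<eta>' by (rule law_prob_space)
  define z where "z = (\<lambda>y. (\<eta>' - \<eta>) * y - (A \<eta>' - A \<eta>))"
  have [measurable]: "z \<in> borel_measurable borel" unfolding z_def by measurable
  have int_z: "integrable (law \<eta>) z"
    unfolding z_def using integrable_law_id[OF \<eta>] by auto
  have exp_z: "exp (z y) = exp (A \<eta> - A \<eta>') * (exp ((\<eta>' - \<eta>) * y) * 1)" for y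
    by (simp add: z_def algebra_simps flip: exp_add)
  have int_exp: "integrable (law \<eta>) (\<lambda>y. exp (z y))"
    unfolding exp_z using integrable_tilt_iff[of "\<lambda>_. 1" \<eta>' \<eta>] by auto
  have one: "expectation (\<lambda>y. exp (z y)) = 1"
    using integral_tilt[of "\<lambda>_. 1" \<eta>' \<eta>] tilted.prob_space by (simp add: z_def)
  have int_k: "integrable (law \<eta>) (\<lambda>y. exp (z y) - 1 - z y)"
    using int_z int_exp by auto
  have k_nonneg: "0 \<le> exp (z y) - 1 - z y" for y
    using exp_ge_add_one_self[of "z y"] by linarith
  have "expectation (\<lambda>y. exp (z y) - 1 - z y) = - expectation z"
    using int_z int_exp prob_space by (simp add: one)
  moreover have "expectation z = (\<eta>' - \<eta>) * expectation (\<lambda>y. y) - (A \<eta>' - A \<eta>)"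
    unfolding z_def using integrable_law_id[OF \<eta>] prob_space by simp
  moreover have "expectation (\<lambda>y. exp (z y) - 1 - z y) \<noteq> 0"
  proof
    assume "expectation (\<lambda>y. exp (z y) - 1 - z y) = 0"
    then have "AE y in law \<eta>. exp (z y) - 1 - z y = 0"
      using integral_nonneg_eq_0_iff_AE[OF int_k] k_nonneg by auto
    moreover have "y = (A \<eta>' - A \<eta>) / (\<eta>' - \<eta>)" if "exp (z y) - 1 - z y = 0" for y
    proof -
      have "z y = 0" using that ln_eq_minus_one[of "exp (z y)"] by simp
      with ne show ?thesis by (simp add: z_def field_simps)
    qed
    ultimately have "AE y in law \<eta>. y = (A \<eta>' - A \<eta>) / (\<eta>' - \<eta>)" by auto
    with law_not_degenerate[OF \<eta>] show False by blast
  qed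
  moreover have "0 \<le> expectation (\<lambda>y. exp (z y) - 1 - z y)"
    by (intro integral_nonneg_AE AE_I2 k_nonneg)
  ultimately show ?thesis by linarith
qed

lemma exists_other_parameter:
  assumes "\<eta> \<in> \<Theta>"
  obtains \<eta>\<^sub>1 where "\<eta>\<^sub>1 \<in> \<Theta>" "\<eta>\<^sub>1 \<noteq> \<eta>"
proof -
  have "\<not> \<Theta> \<subseteq> {\<eta>}"
    using parameter_interval(2) interior_mono[of \<Theta> "{\<eta>}"] by auto
  then show ?thesis using that by auto
qed

text \<open>
  Along a sequence in \<open>\<Theta>\<close> tending to \<open>\<eta>\<close>, the identity \<open>exp (A \<eta>\<^sub>n - A \<eta>) = E exp ((\<eta>\<^sub>n - \<eta>) Y)\<close> may
  be differentiated under the expectation. One sequence is enough because \<open>A\<close> is known to be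
  differentiable. Choosing it on the segment from \<open>\<eta>\<close> to another parameter \<open>\<eta>\<^sub>1\<close> covers the endpoints
  of \<open>\<Theta>\<close>, and dominates the difference quotients by \<open>y (2 + exp ((\<eta>\<^sub>1 - \<eta>) y))\<close>, which is integrable
  because the law with parameter \<open>\<eta>\<^sub>1\<close> has a finite mean.
\<close>

lemma mean_eq_derivative:
  assumes \<eta>: "\<eta> \<in> \<Theta>"
  shows "integral\<^sup>L (law \<eta>) (\<lambda>y. y) = B \<eta>"
proof -
  interpret prob_space "law \<eta>" using \<eta> by (rule law_prob_space)
  obtain \<eta>\<^sub>1 where \<eta>\<^sub>1: "\<eta>\<^sub>1 \<in> \<Theta>" "\<eta>\<^sub>1 \<noteq> \<eta>" using exists_other_parameter[OF \<eta>] .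
  define d where "d = \<eta>\<^sub>1 - \<eta>"
  \<comment> \<open>The point \<open>\<eta> + \<epsilon> n\<close> lies on the segment from \<open>\<eta>\<close> to \<open>\<eta>\<^sub>1\<close>, hence in \<open>\<Theta>\<close>.\<close>
  define \<epsilon> where "\<epsilon> = (\<lambda>n::nat. d / real (Suc n))"
  have \<epsilon>_ne: "\<epsilon> n \<noteq> 0" for n using \<eta>\<^sub>1 by (simp add: \<epsilon>_def d_def)
  have \<epsilon>_lim: "\<epsilon> \<longlonglongrightarrow> 0"
    unfolding \<epsilon>_def by (rule LIMSEQ_Suc[OF lim_const_over_n])
  have in_\<Theta>: "\<eta> + \<epsilon> n \<in> \<Theta>" for n
  proof -
    have "convex \<Theta>" using parameter_interval(1) by (simp add: is_interval_convex)
    then have "(1 - 1 / real (Suc n)) *\<^sub>R \<eta> + (1 / real (Suc n)) *\<^sub>R \<eta>\<^sub>1 \<in> \<Theta>"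
      using \<eta> \<eta>\<^sub>1 by (intro convexD) auto
    also have "(1 - 1 / real (Suc n)) *\<^sub>R \<eta> + (1 / real (Suc n)) *\<^sub>R \<eta>\<^sub>1 = \<eta> + \<epsilon> n"
      by (simp add: \<epsilon>_def d_def algebra_simps add_divide_distrib diff_divide_distrib)
    finally show ?thesis .
  qed
  have approach: "filterlim (\<lambda>n. \<eta> + \<epsilon> n) (at \<eta> within \<Theta>) sequentially"
    unfolding filterlim_at using in_\<Theta> \<epsilon>_ne tendsto_add[OF tendsto_const \<epsilon>_lim, of \<eta>] by simp
  have "((\<lambda>t. exp (A t - A \<eta>)) has_real_derivative exp (A \<eta> - A \<eta>) * (B \<eta> - 0)) (at \<eta> within \<Theta>)"
    by (intro derivative_intros A_derivative[OF \<eta>])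
  then have "((\<lambda>t. (exp (A t - A \<eta>) - 1) / (t - \<eta>)) \<longlongrightarrow> B \<eta>) (at \<eta> within \<Theta>)"
    by (simp add: has_field_derivative_iff)
  from filterlim_compose[OF this approach]
  have lim_B: "(\<lambda>n. (exp (A (\<eta> + \<epsilon> n) - A \<eta>) - 1) / \<epsilon> n) \<longlonglongrightarrow> B \<eta>" by simp

  have int_exp: "integrable (law \<eta>) (\<lambda>y. exp (\<epsilon> n * y))" for n
  proof -
    interpret tilted: prob_space "law (\<eta> + \<epsilon> n)" using in_\<Theta> by (rule law_prob_space)
    show ?thesis using integrable_tilt_iff[of "\<lambda>_. 1" "\<eta> + \<epsilon> n" \<eta>] by simp
  qed
  have "exp (A (\<eta> + \<epsilon> n) - A \<eta>) = expectation (\<lambda>y. exp (\<epsilon> n * y))" for n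
  proof -
    interpret tilted: prob_space "law (\<eta> + \<epsilon> n)" using in_\<Theta> by (rule law_prob_space)
    have "1 = expectation (\<lambda>y. exp (\<epsilon> n * y - (A (\<eta> + \<epsilon> n) - A \<eta>)))"
      using integral_tilt[of "\<lambda>_. 1" "\<eta> + \<epsilon> n" \<eta>] tilted.prob_space by simp
    also have "\<dots> = expectation (\<lambda>y. exp (\<epsilon> n * y)) / exp (A (\<eta> + \<epsilon> n) - A \<eta>)"
      by (simp add: exp_diff)
    finally show ?thesis by simp
  qed
  then have quot: "(exp (A (\<eta> + \<epsilon> n) - A \<eta>) - 1) / \<epsilon> n =
      expectation (\<lambda>y. (exp (\<epsilon> n * y) - 1) / \<epsilon> n)" for n
    using int_exp[of n] prob_space by simp

  have bound: "\<bar>(exp (\<epsilon> n * y) - 1) / \<epsilon> n\<bar> \<le> 2 * y + exp (d * y) * y" if y: "0 \<le> y" for n y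
  proof -
    have e: "\<bar>exp s - 1\<bar> \<le> \<bar>s\<bar> * (1 + exp s)" for s :: real
    proof (cases "0 \<le> s")
      case True
      have "1 - s \<le> exp (- s)" using exp_ge_add_one_self[of "- s"] by simp
      then have "exp s * (1 - s) \<le> exp s * exp (- s)" by (intro mult_left_mono) auto
      moreover have "exp s * exp (- s) = 1" by (simp flip: exp_add)
      ultimately have "exp s - 1 \<le> s * exp s" by (simp add: algebra_simps)
      moreover have "1 \<le> exp s" using True by simp
      ultimately show ?thesis using True by (simp add: algebra_simps)
    next
      case False
      then have "exp s \<le> 1" by simp
      moreover have "1 + s \<le> exp s" by (rule exp_ge_add_one_self)
      moreover have "0 \<le> - s * exp s" using False by (intro mult_nonneg_nonneg) auto
      moreover have "\<bar>s\<bar> * (1 + exp s) = - s + - s * exp s" using False by (simp add: algebra_simps)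
      ultimately show ?thesis by linarith
    qed
    \<comment> \<open>\<open>\<epsilon> n\<close> lies between \<open>0\<close> and \<open>d\<close>, on the side given by the sign of \<open>d\<close>.\<close>
    have *: "exp (\<epsilon> n * y) \<le> exp (d * y) \<or> exp (\<epsilon> n * y) \<le> 1"
    proof (cases "0 \<le> d")
      case True
      then have "\<epsilon> n \<le> d" by (simp add: \<epsilon>_def divide_le_eq mult_le_cancel_left1)
      then show ?thesis using y by (auto intro: mult_right_mono)
    next
      case False
      then have "\<epsilon> n \<le> 0" by (simp add: \<epsilon>_def divide_le_0_iff)
      then show ?thesis using y by (auto simp: mult_le_0_iff)
    qed
    have "\<bar>(exp (\<epsilon> n * y) - 1) / \<epsilon> n\<bar> \<le> \<bar>\<epsilon> n * y\<bar> * (1 + exp (\<epsilon> n * y)) / \<bar>\<epsilon> n\<bar>"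
      unfolding abs_divide by (intro divide_right_mono e) simp
    also have "\<dots> = y * (1 + exp (\<epsilon> n * y))"
      using \<epsilon>_ne[of n] y by (simp add: abs_mult)
    also have "\<dots> \<le> y * (2 + exp (d * y))"
      using * y exp_ge_zero[of "d * y"] by (intro mult_left_mono) linarith+
    finally show ?thesis by (simp add: algebra_simps)
  qed
  have "integrable (law \<eta>) (\<lambda>y. exp (d * y) * y)"
    unfolding d_def by (rule integrable_tilt_iff[THEN iffD1, OF _ integrable_law_id[OF \<eta>\<^sub>1(1)]]) simp
  then have "integrable (law \<eta>) (\<lambda>y. 2 * y + exp (d * y) * y)"
    by (intro Bochner_Integration.integrable_add) (simp_all add: integrable_law_id[OF \<eta>])
  then have "(\<lambda>n. expectation (\<lambda>y. (exp (\<epsilon> n * y) - 1) / \<epsilon> n)) \<longlonglongrightarrow> expectation (\<lambda>y. y)"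
  proof (rule integral_dominated_convergence[rotated 2])
    have "(\<lambda>n. (exp (\<epsilon> n * y) - 1) / \<epsilon> n) \<longlonglongrightarrow> y" for y
    proof -
      have "((\<lambda>t. exp (t * y)) has_real_derivative exp (0 * y) * (1 * y)) (at 0)"
        by (auto intro!: derivative_eq_intros)
      then have "((\<lambda>t. (exp (t * y) - 1) / t) \<longlongrightarrow> y) (at 0)"
        by (simp add: has_field_derivative_iff)
      moreover have "filterlim \<epsilon> (at 0) sequentially"
        unfolding filterlim_at using \<epsilon>_lim \<epsilon>_ne by simp
      ultimately show ?thesis by (rule filterlim_compose)
    qed
    then show "AE y in law \<eta>. (\<lambda>n. (exp (\<epsilon> n * y) - 1) / \<epsilon> n) \<longlonglongrightarrow> y" by simp
    show "AE y in law \<eta>. norm ((exp (\<epsilon> n * y) - 1) / \<epsilon> n) \<le> 2 * y + exp (d * y) * y" for n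
      using AE_law_nonneg by eventually_elim (simp only: real_norm_def bound)
  qed simp_all
  with lim_B show ?thesis unfolding quot by (rule LIMSEQ_unique[symmetric])
qed

text \<open>
  Add the strict tangent inequalities at the two parameters.
\<close>

lemma strict_mono_on_derivative: "strict_mono_on \<Theta> B"
proof (rule strict_mono_onI)
  fix \<eta> \<eta>' assume *: "\<eta> \<in> \<Theta>" "\<eta>' \<in> \<Theta>" "\<eta> < \<eta>'"
  have "(\<eta>' - \<eta>) * B \<eta> < A \<eta>' - A \<eta>" "(\<eta> - \<eta>') * B \<eta>' < A \<eta> - A \<eta>'"
    using above_tangent[of \<eta> \<eta>'] above_tangent[of \<eta>' \<eta>] * by (auto simp: mean_eq_derivative)
  then have "(\<eta>' - \<eta>) * B \<eta> < (\<eta>' - \<eta>) * B \<eta>'" by (simp add: algebra_simps)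
  with * show "B \<eta> < B \<eta>'" by simp
qed

text \<open>
  The likelihood ratio of two members of the family is increasing in the observation, so it crosses
  \<open>1\<close> at most once, from below: the laws are stochastically ordered by the parameter. At the point
  \<open>t\<close> the ratio is either at most \<open>1\<close>, and then so on \<open>{..t}\<close>, or at least \<open>1\<close>, and then so on \<open>{t<..}\<close>.
\<close>

lemma cdf_law_antimono:
  assumes \<eta>: "\<eta> \<in> \<Theta>" and \<eta>': "\<eta>' \<in> \<Theta>" and le: "\<eta> \<le> \<eta>'"
  shows "cdf (law \<eta>') t \<le> cdf (law \<eta>) t"
proof -
  interpret p: prob_space "law \<eta>" using \<eta> by (rule law_prob_space)
  interpret p': prob_space "law \<eta>'" using \<eta>' by (rule law_prob_space)
  define z where "z = (\<lambda>y. (\<eta>' - \<eta>) * y - (A \<eta>' - A \<eta>))"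
  have [measurable]: "z \<in> borel_measurable borel" unfolding z_def by measurable
  have z_mono: "z s \<le> z y" if "s \<le> y" for s y
    using that le by (simp add: z_def mult_left_mono)
  have em: "emeasure (law \<eta>') C = (\<integral>\<^sup>+y. ennreal (exp (z y)) * indicator C y \<partial>law \<eta>)"
    if "C \<in> sets borel" for C
    unfolding z_def by (subst law_tilt[of \<eta>' \<eta>], subst emeasure_density) (use that in simp_all)
  show ?thesis
  proof (cases "z t \<le> 0")
    case True
    have "emeasure (law \<eta>') {..t} \<le> (\<integral>\<^sup>+y. indicator {..t} y \<partial>law \<eta>)"
    proof (subst em)
      have "ennreal (exp (z y)) * indicator {..t} y \<le> indicator {..t} y" for y
        using True z_mono[of y t] by (cases "y \<le> t") auto
      then show "(\<integral>\<^sup>+y. ennreal (exp (z y)) * indicator {..t} y \<partial>law \<eta>) \<le> (\<integral>\<^sup>+y. indicator {..t} y \<partial>law \<eta>)"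
        by (rule nn_integral_mono)
    qed simp
    then have "emeasure (law \<eta>') {..t} \<le> emeasure (law \<eta>) {..t}" by simp
    then show ?thesis
      unfolding cdf_def p.emeasure_eq_measure p'.emeasure_eq_measure by simp
  next
    case False
    have "(\<integral>\<^sup>+y. indicator {t<..} y \<partial>law \<eta>) \<le> emeasure (law \<eta>') {t<..}"
    proof (subst em)
      have "indicator {t<..} y \<le> ennreal (exp (z y)) * indicator {t<..} y" for y
        using False z_mono[of t y] by (cases "t < y") auto
      then show "(\<integral>\<^sup>+y. indicator {t<..} y \<partial>law \<eta>) \<le> (\<integral>\<^sup>+y. ennreal (exp (z y)) * indicator {t<..} y \<partial>law \<eta>)"
        by (rule nn_integral_mono)
    qed simp
    then have "emeasure (law \<eta>) {t<..} \<le> emeasure (law \<eta>') {t<..}" by simp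
    then have "measure (law \<eta>) {t<..} \<le> measure (law \<eta>') {t<..}"
      unfolding p.emeasure_eq_measure p'.emeasure_eq_measure by simp
    moreover have "UNIV - {t<..} = {..t}" by auto
    ultimately show ?thesis
      using p.prob_compl[of "{t<..}"] p'.prob_compl[of "{t<..}"] by (simp add: cdf_def)
  qed
qed

end

section \<open>Quantile functions\<close>

lemma prob_space_uniform01: "prob_space uniform01"
  by (rule prob_space_uniform_measure) simp_all

lemma AE_uniform01: "AE u in uniform01. u \<in> {0<..<1}"
  by (subst AE_uniform_measure) simp_all

lemma measure_uniform01_atMost:
  assumes "0 \<le> c" "c \<le> 1"
  shows "measure uniform01 {..c} = c"
proof -
  have "measure uniform01 {..c} = measure lborel ({0<..<1} \<inter> {..c})"
    by (subst measure_uniform_measure) simp_all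
  also have "\<dots> = measure lborel {0<..c}"
  proof (rule measure_eq_AE)
    show "AE x in lborel. x \<in> {0<..<1} \<inter> {..c} \<longleftrightarrow> x \<in> {0<..c}"
      using AE_lborel_singleton[of "1::real"] by eventually_elim (use assms in auto)
  qed simp_all
  finally show ?thesis using assms by simp
qed

lemma cdf_eq_0_of_nonneg:
  assumes "real_distribution L" and "AE y in L. 0 \<le> y" and "t < 0"
  shows "cdf L t = 0"
proof -
  interpret real_distribution L by fact
  have "AE y in L. y \<notin> {..t}" using assms(2) by eventually_elim (use assms(3) in auto)
  then show ?thesis unfolding cdf_def by (subst prob_eq_0) simp_all
qed

text \<open>
  Quantile function and distribution function form a Galois connection, which reduces questions
  about quantiles to questions about distribution functions. The condition \<open>0 \<le> t\<close> in the definition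
  of a quantile excludes no relevant point, since the distribution function vanishes on the negatives.
\<close>

lemma quantile_le_iff:
  assumes L: "real_distribution L" "AE y in L. 0 \<le> y" and u: "u \<in> {0<..<1}"
  shows "quantile L u \<le> t \<longleftrightarrow> u \<le> cdf L t"
proof -
  interpret cdf_distribution L using L(1) by (simp add: cdf_distribution_def)
  have "{t. 0 \<le> t \<and> u \<le> cdf L t} = {t. u \<le> cdf L t}"
    using cdf_eq_0_of_nonneg[OF L] u by (force simp: not_less[symmetric])
  then show ?thesis
    unfolding quantile_def using pseudoinverse[of u t] u by simp
qed

lemma quantile_nonneg:
  assumes "real_distribution L" "AE y in L. 0 \<le> y" "u \<in> {0<..<1}"
  shows "0 \<le> quantile L u"
  using quantile_le_iff[OF assms, of "quantile L u"] cdf_eq_0_of_nonneg[OF assms(1,2), of "quantile L u"]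
    assms(3) by (cases "quantile L u < 0") auto

lemma quantile_antimono_cdf:
  assumes L: "real_distribution L" "AE y in L. 0 \<le> y"
    and L': "real_distribution L'" "AE y in L'. 0 \<le> y"
    and le: "\<And>t. cdf L' t \<le> cdf L t" and u: "u \<in> {0<..<1}"
  shows "quantile L u \<le> quantile L' u"
  using quantile_le_iff[OF L' u, of "quantile L' u"] quantile_le_iff[OF L u, of "quantile L' u"]
    le[of "quantile L' u"] by simp

text \<open>
  The distribution function of a law on the integers is constant between integers, so the infimum
  that defines a quantile is attained at an integer.
\<close>

lemma quantile_in_Nats:
  assumes L: "real_distribution L" "AE y in L. 0 \<le> y" and N: "AE y in L. y \<in> \<nat>"
    and u: "u \<in> {0<..<1}"
  shows "quantile L u \<in> \<nat>"
proof -
  interpret real_distribution L by fact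
  define q where "q = quantile L u"
  have "cdf L q = cdf L (of_int \<lfloor>q\<rfloor>)"
    unfolding cdf_def
  proof (rule measure_eq_AE)
    show "AE y in L. (y \<in> {..q}) = (y \<in> {..of_int \<lfloor>q\<rfloor>})"
      using N
    proof eventually_elim
      case (elim y)
      then obtain k where "y = real k" by (auto elim: Nats_cases)
      then have "y = of_int (int k)" by simp
      then show ?case using le_floor_iff[of "int k" q] by (simp del: of_int_of_nat_eq)
    qed
  qed simp_all
  then have "q \<le> of_int \<lfloor>q\<rfloor>"
    using quantile_le_iff[OF L u, of q] quantile_le_iff[OF L u, of "of_int \<lfloor>q\<rfloor>"] by (simp add: q_def)
  then have "q = of_int \<lfloor>q\<rfloor>" by linarith
  moreover have "0 \<le> \<lfloor>q\<rfloor>" using quantile_nonneg[OF L u] by (simp add: q_def)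
  ultimately have "q = real (nat \<lfloor>q\<rfloor>)" by simp
  then show ?thesis unfolding q_def[symmetric] by (metis of_nat_in_Nats)
qed

text \<open>
  Outside \<open>(0,1)\<close> a quantile may be the infimum of an empty set. The value is replaced by \<open>0\<close> there,
  on a null set of the uniform distribution.
\<close>

lemma borel_measurable_quantile:
  assumes L: "real_distribution L" "AE y in L. 0 \<le> y"
  shows "(\<lambda>u. if u \<in> {0<..<1} then quantile L u else 0) \<in> borel_measurable borel"
proof -
  have "mono_on {0<..<1} (quantile L)"
  proof (rule mono_onI)
    fix u v :: real assume uv: "u \<in> {0<..<1}" "v \<in> {0<..<1}" "u \<le> v"
    show "quantile L u \<le> quantile L v"
      using quantile_le_iff[OF L uv(1), of "quantile L v"] quantile_le_iff[OF L uv(2), of "quantile L v"]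
        uv(3) by simp
  qed
  then have "quantile L \<in> borel_measurable (restrict_space borel {0<..<1})"
    by (rule borel_measurable_mono_on_fnc)
  then show ?thesis
    by (subst measurable_If_restrict_space_iff) (simp_all del: greaterThanLessThan_iff)
qed

text \<open>
  Inverse transform sampling: one uniform variable realises all laws on the half line simultaneously.
\<close>

lemma distr_quantile:
  assumes L: "real_distribution L" "AE y in L. 0 \<le> y"
  shows "distr uniform01 borel (\<lambda>u. if u \<in> {0<..<1} then quantile L u else 0) = L"
    (is "distr _ _ ?q = L")
proof (rule cdf_unique)
  interpret L: real_distribution L by fact
  interpret U: prob_space uniform01 by (rule prob_space_uniform01)
  have q [measurable]: "?q \<in> borel_measurable borel" by (rule borel_measurable_quantile[OF L])
  then have q': "?q \<in> borel_measurable uniform01" by simp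
  show "real_distribution (distr uniform01 borel ?q)"
    using q' by (simp add: U.real_distribution_distr)
  show "cdf (distr uniform01 borel ?q) = cdf L"
  proof
    fix t
    have "cdf (distr uniform01 borel ?q) t = measure uniform01 (?q -` {..t} \<inter> space uniform01)"
      unfolding cdf_def using q' by (rule measure_distr) simp
    also have "\<dots> = measure uniform01 {..cdf L t}"
    proof (rule measure_eq_AE)
      show "AE u in uniform01. (u \<in> ?q -` {..t} \<inter> space uniform01) = (u \<in> {..cdf L t})"
        using AE_uniform01 by eventually_elim (simp add: quantile_le_iff[OF L])
      show "?q -` {..t} \<inter> space uniform01 \<in> sets uniform01"
        using q' by (rule measurable_sets) simp
    qed simp
    also have "\<dots> = cdf L t"
      by (rule measure_uniform01_atMost) (simp_all add: L.cdf_nonneg L.cdf_bounded_prob)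
    finally show "cdf (distr uniform01 borel ?q) t = cdf L t" .
  qed
qed fact

section \<open>Iterated random maps that contract in mean\<close>

text \<open>
  Used with \<open>S = UNIV\<close> to discard the driving variables after time \<open>n\<close>, and with the state space as
  \<open>S\<close> to exchange the random maps for versions that agree with them on the state space only.
\<close>

lemma backward_cong_on:
  assumes "\<And>t x. 1 \<le> t \<Longrightarrow> t \<le> n \<Longrightarrow> x \<in> S \<Longrightarrow> f (\<theta> t) x = f' (\<theta>' t) x \<and> f' (\<theta>' t) x \<in> S" and "x \<in> S"
  shows "backward f \<theta> n x = backward f' \<theta>' n x"
  using assms
proof (induction n arbitrary: x)
  case (Suc n)
  have "f (\<theta> (Suc n)) x = f' (\<theta>' (Suc n)) x" "f' (\<theta>' (Suc n)) x \<in> S"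
    using Suc.prems(1)[of "Suc n" x] Suc.prems(2) by simp_all
  then show ?case using Suc.IH[of "f' (\<theta>' (Suc n)) x"] Suc.prems(1) by simp
qed simp

lemma forward_cong_on:
  assumes "\<And>t x. 1 \<le> t \<Longrightarrow> t \<le> n \<Longrightarrow> x \<in> S \<Longrightarrow> f (\<theta> t) x = f' (\<theta>' t) x \<and> f' (\<theta>' t) x \<in> S" and "x \<in> S"
  shows "forward f \<theta> n x = forward f' \<theta>' n x \<and> forward f' \<theta>' n x \<in> S"
  using assms(1)
proof (induction n)
  case 0
  then show ?case using assms(2) by simp
next
  case (Suc n)
  then have "forward f \<theta> n x = forward f' \<theta>' n x" "forward f' \<theta>' n x \<in> S" by auto
  then show ?case using Suc.prems[of "Suc n" "forward f' \<theta>' n x"] by simp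
qed

text \<open>
  By monotone convergence the sum has a finite integral, so it is finite almost everywhere.
\<close>

lemma AE_summable_geometric:
  fixes f :: "nat \<Rightarrow> 'a \<Rightarrow> real"
  assumes [measurable]: "\<And>n. f n \<in> borel_measurable M"
    and bound: "\<And>n. (\<integral>\<^sup>+\<omega>. ennreal \<bar>f n \<omega>\<bar> \<partial>M) \<le> ennreal (K * c ^ n)"
    and c: "0 \<le> c" "c < 1" and K: "0 \<le> K"
  shows "AE \<omega> in M. summable (\<lambda>n. \<bar>f n \<omega>\<bar>)" and "integrable M (\<lambda>\<omega>. \<Sum>n. \<bar>f n \<omega>\<bar>)"
proof -
  have sums: "summable (\<lambda>n. K * c ^ n)"
    using c by (intro summable_mult summable_geometric) auto
  have "(\<integral>\<^sup>+\<omega>. (\<Sum>n. ennreal \<bar>f n \<omega>\<bar>) \<partial>M) = (\<Sum>n. \<integral>\<^sup>+\<omega>. ennreal \<bar>f n \<omega>\<bar> \<partial>M)"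
    by (rule nn_integral_suminf) measurable
  also have "\<dots> \<le> (\<Sum>n. ennreal (K * c ^ n))"
  proof (rule suminf_le)
    show "(\<integral>\<^sup>+\<omega>. ennreal \<bar>f n \<omega>\<bar> \<partial>M) \<le> ennreal (K * c ^ n)" for n by (rule bound)
  qed simp_all
  also have "\<dots> < \<infinity>"
  proof -
    have "0 \<le> K * c ^ n" for n using c K by simp
    from ennreal_suminf_neq_top[OF sums this] show ?thesis
      unfolding infinity_ennreal_def by (rule top.not_eq_extremum[THEN iffD1])
  qed
  finally have fin: "(\<integral>\<^sup>+\<omega>. (\<Sum>n. ennreal \<bar>f n \<omega>\<bar>) \<partial>M) < \<infinity>" .
  then have "AE \<omega> in M. (\<Sum>n. ennreal \<bar>f n \<omega>\<bar>) \<noteq> \<infinity>"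
    by (intro nn_integral_PInf_AE) auto
  then show ae: "AE \<omega> in M. summable (\<lambda>n. \<bar>f n \<omega>\<bar>)"
  proof eventually_elim
    case (elim \<omega>)
    then show ?case by (intro summable_suminf_not_top) simp_all
  qed
  have "(\<integral>\<^sup>+\<omega>. ennreal (norm (\<Sum>n. \<bar>f n \<omega>\<bar>)) \<partial>M) = (\<integral>\<^sup>+\<omega>. (\<Sum>n. ennreal \<bar>f n \<omega>\<bar>) \<partial>M)"
  proof (rule nn_integral_cong_AE)
    show "AE \<omega> in M. ennreal (norm (\<Sum>n. \<bar>f n \<omega>\<bar>)) = (\<Sum>n. ennreal \<bar>f n \<omega>\<bar>)"
      using ae
    proof eventually_elim
      case (elim \<omega>)
      have "(\<Sum>n. ennreal \<bar>f n \<omega>\<bar>) = ennreal (\<Sum>n. \<bar>f n \<omega>\<bar>)"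
        by (rule suminf_ennreal2) (use elim in simp_all)
      moreover have "0 \<le> (\<Sum>n. \<bar>f n \<omega>\<bar>)" by (rule suminf_nonneg[OF elim]) simp
      ultimately show ?case by simp
    qed
  qed
  with fin show "integrable M (\<lambda>\<omega>. \<Sum>n. \<bar>f n \<omega>\<bar>)"
    by (intro integrableI_bounded) simp_all
qed

text \<open>
  The piecewise linear function \<open>cts_step s t\<close> lies between the indicators of \<open>{..s}\<close> and \<open>{..t}\<close>.
  Letting \<open>t\<close> decrease to \<open>s\<close>, right continuity of the distribution functions gives equality. Hence
  Lipschitz test functions with values in \<open>[0,1]\<close> determine a law on the line.
\<close>

lemma measure_eqI_cts_step:
  assumes M: "real_distribution M" and M': "real_distribution M'"
    and eq: "\<And>s t. s < t \<Longrightarrow> integral\<^sup>L M (cts_step s t) = integral\<^sup>L M' (cts_step s t)"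
  shows "M = M'"
proof (rule cdf_unique[OF M M'], rule ext)
  have le: "cdf L s \<le> cdf L' s"
    if L: "real_distribution L" and L': "real_distribution L'"
      and e: "\<And>s t. s < t \<Longrightarrow> integral\<^sup>L L (cts_step s t) = integral\<^sup>L L' (cts_step s t)" for L L' s
  proof -
    interpret L: real_distribution L by fact
    interpret L': real_distribution L' by fact
    have "(cdf L' \<longlongrightarrow> cdf L' s) (at_right s)"
      using L'.cdf_is_right_cont by (simp add: continuous_within)
    moreover have "cdf L s \<le> cdf L' t" if "s < t" for t
      using L.cdf_cts_step(1)[OF that] L'.cdf_cts_step(2)[OF that] e[OF that] by simp
    then have "\<forall>\<^sub>F t in at_right s. cdf L s \<le> cdf L' t"
      by (auto simp: eventually_at_right[of s "s + 1"] intro!: exI[of _ "s + 1"])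
    ultimately show ?thesis by (rule tendsto_lowerbound) simp
  qed
  show "cdf M s = cdf M' s" for s
    using le[OF M M' eq] le[OF M' M eq[symmetric]] by (simp add: antisym)
qed

lemma cts_step_bounds: "s < t \<Longrightarrow> 0 \<le> cts_step s t x" "s < t \<Longrightarrow> cts_step s t x \<le> 1"
  by (auto simp: cts_step_def divide_simps)

lemma borel_measurable_cts_step: "cts_step s t \<in> borel_measurable borel"
  unfolding cts_step_def[abs_def] by measurable

lemma cts_step_lipschitz:
  assumes "s < t"
  shows "\<bar>cts_step s t x - cts_step s t y\<bar> \<le> \<bar>x - y\<bar> / (t - s)"
proof -
  have clamp: "cts_step s t z = max 0 (min 1 ((t - z) / (t - s)))" for z
    using assms by (auto simp: cts_step_def max_def min_def field_simps)
  have "\<bar>cts_step s t x - cts_step s t y\<bar> \<le> \<bar>(t - x) / (t - s) - (t - y) / (t - s)\<bar>"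
    unfolding clamp by linarith
  also have "\<dots> = \<bar>(y - x) / (t - s)\<bar>" by (simp add: diff_divide_distrib)
  also have "\<dots> = \<bar>x - y\<bar> / (t - s)" using assms by (simp add: abs_divide abs_minus_commute)
  finally show ?thesis .
qed

text \<open>
  Random maps \<open>F u\<close> of a closed set \<open>S\<close> of reals that contract by the factor \<open>c\<close> after averaging over
  \<open>u\<close>; a single map may expand distances and may be discontinuous.
\<close>

locale mean_contracting_maps = prob_space T for T :: "'t measure" +
  fixes F :: "'t \<Rightarrow> real \<Rightarrow> real" and S :: "real set" and c :: real
  assumes F_measurable: "(\<lambda>(u, x). F u x) \<in> borel_measurable (T \<Otimes>\<^sub>M borel)"
    and closed_S: "closed S" and S_nonempty: "S \<noteq> {}"
    and F_in_S: "\<And>u x. u \<in> space T \<Longrightarrow> x \<in> S \<Longrightarrow> F u x \<in> S"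
    and factor: "0 \<le> c" "c < 1"
    and mean_contraction: "\<And>x x'. x \<in> S \<Longrightarrow> x' \<in> S \<Longrightarrow>
      (\<integral>\<^sup>+u. ennreal \<bar>F u x - F u x'\<bar> \<partial>T) \<le> ennreal (c * \<bar>x - x'\<bar>)"
    and mean_displacement: "\<And>x. x \<in> S \<Longrightarrow> (\<integral>\<^sup>+u. ennreal \<bar>F u x - x\<bar> \<partial>T) < \<infinity>"
begin

lemma measurable_F [measurable (raw)]:
  "f \<in> N \<rightarrow>\<^sub>M T \<Longrightarrow> X \<in> borel_measurable N \<Longrightarrow> (\<lambda>\<omega>. F (f \<omega>) (X \<omega>)) \<in> borel_measurable N"
  using measurable_compose[OF measurable_Pair F_measurable, of f N X] by simp

lemma measurable_backward [measurable (raw)]: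
  assumes "\<And>t. 1 \<le> t \<Longrightarrow> t \<le> n \<Longrightarrow> U t \<in> N \<rightarrow>\<^sub>M T" and "X \<in> borel_measurable N"
  shows "(\<lambda>\<omega>. backward F (\<lambda>t. U t \<omega>) n (X \<omega>)) \<in> borel_measurable N"
  using assms by (induction n arbitrary: X) (simp_all add: measurable_F)

lemma measurable_forward [measurable (raw)]:
  assumes "\<And>t. 1 \<le> t \<Longrightarrow> t \<le> n \<Longrightarrow> U t \<in> N \<rightarrow>\<^sub>M T" and "X \<in> borel_measurable N"
  shows "(\<lambda>\<omega>. forward F (\<lambda>t. U t \<omega>) n (X \<omega>)) \<in> borel_measurable N"
  using assms by (induction n) (simp_all add: measurable_F)

lemma backward_in_S:
  assumes "\<And>t. 1 \<le> t \<Longrightarrow> t \<le> n \<Longrightarrow> \<theta> t \<in> space T" "x \<in> S"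
  shows "backward F \<theta> n x \<in> S"
  using assms by (induction n arbitrary: x) (simp_all add: F_in_S)

lemma forward_in_S:
  assumes "\<And>t. 1 \<le> t \<Longrightarrow> t \<le> n \<Longrightarrow> \<theta> t \<in> space T" "x \<in> S"
  shows "forward F \<theta> n x \<in> S"
  using assms by (induction n) (simp_all add: F_in_S)

abbreviation W :: "nat \<Rightarrow> (nat \<Rightarrow> 't) measure" where
  "W n \<equiv> \<Pi>\<^sub>M t\<in>{1..n}. T"

sublocale W: product_prob_space "\<lambda>_::nat. T" "I" for I
  by unfold_locales

lemma space_W: "\<theta> \<in> space (W n) \<Longrightarrow> 1 \<le> t \<Longrightarrow> t \<le> n \<Longrightarrow> \<theta> t \<in> space T"
  by (auto simp: space_PiM)

lemma measurable_W [measurable (raw)]: "1 \<le> t \<Longrightarrow> t \<le> n \<Longrightarrow> (\<lambda>\<theta>. \<theta> t) \<in> W n \<rightarrow>\<^sub>M T"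
  by (rule measurable_component_singleton) simp

text \<open>
  The last driving variable can be integrated out last or first. The first form suits the backward
  process, in which the last map acts on the starting point; the second form suits the forward
  process, in which it acts on the state reached so far.
\<close>

lemma nn_integral_W_Suc:
  assumes "f \<in> borel_measurable (W (Suc n))"
  shows "integral\<^sup>N (W (Suc n)) f = (\<integral>\<^sup>+v. \<integral>\<^sup>+\<theta>. f (\<theta>(Suc n := v)) \<partial>W n \<partial>T)"
    and "integral\<^sup>N (W (Suc n)) f = (\<integral>\<^sup>+\<theta>. \<integral>\<^sup>+v. f (\<theta>(Suc n := v)) \<partial>T \<partial>W n)"
  using assms W.product_nn_integral_insert_rev[of "{1..n}" "Suc n" f]
    W.product_nn_integral_insert[of "{1..n}" "Suc n" f]
  by (simp_all add: atLeastAtMostSuc_conv)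

lemma backward_fun_upd: "m \<le> n \<Longrightarrow> backward F (\<theta>(Suc n := v)) m x = backward F \<theta> m x"
  by (rule backward_cong_on[where S=UNIV]) auto

lemma forward_fun_upd: "m \<le> n \<Longrightarrow> forward F (\<theta>(Suc n := v)) m x = forward F \<theta> m x"
  by (rule forward_cong_on[where S=UNIV, THEN conjunct1]) auto

lemma measurable_backward_W [measurable]: "m \<le> n \<Longrightarrow> (\<lambda>\<theta>. backward F \<theta> m x) \<in> borel_measurable (W n)"
  by (rule measurable_backward[where U="\<lambda>t \<theta>. \<theta> t"]) (simp_all add: measurable_W)

lemma measurable_forward_W [measurable]: "m \<le> n \<Longrightarrow> (\<lambda>\<theta>. forward F \<theta> m x) \<in> borel_measurable (W n)"
  by (rule measurable_forward[where U="\<lambda>t \<theta>. \<theta> t"]) (simp_all add: measurable_W)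

text \<open>
  Given the last driving variable \<open>v\<close>, the two backward processes continue from \<open>F v x\<close> and
  \<open>F v x'\<close>, and these two points are already closer in mean by the factor \<open>c\<close>.
\<close>

lemma backward_contraction:
  assumes "x \<in> S" "x' \<in> S"
  shows "(\<integral>\<^sup>+\<theta>. ennreal \<bar>backward F \<theta> n x - backward F \<theta> n x'\<bar> \<partial>W n) \<le> ennreal (c ^ n * \<bar>x - x'\<bar>)"
  using assms
proof (induction n arbitrary: x x')
  case 0
  have "emeasure (W 0) (space (W 0)) = 1" by (rule W.P.emeasure_space_1)
  then show ?case by simp
next
  case (Suc n)
  have "(\<integral>\<^sup>+\<theta>. ennreal \<bar>backward F \<theta> (Suc n) x - backward F \<theta> (Suc n) x'\<bar> \<partial>W (Suc n)) =
      (\<integral>\<^sup>+v. \<integral>\<^sup>+\<theta>. ennreal \<bar>backward F \<theta> n (F v x) - backward F \<theta> n (F v x')\<bar> \<partial>W n \<partial>T)"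
    by (subst nn_integral_W_Suc(1)) (measurable, simp add: backward_fun_upd)
  also have "\<dots> \<le> (\<integral>\<^sup>+v. ennreal (c ^ n * \<bar>F v x - F v x'\<bar>) \<partial>T)"
    using Suc by (intro nn_integral_mono Suc.IH F_in_S) auto
  also have "\<dots> = ennreal (c ^ n) * (\<integral>\<^sup>+v. ennreal \<bar>F v x - F v x'\<bar> \<partial>T)"
    using factor by (subst nn_integral_cmult[symmetric]) (measurable, simp add: ennreal_mult)
  also have "\<dots> \<le> ennreal (c ^ n) * ennreal (c * \<bar>x - x'\<bar>)"
    using Suc.prems by (intro mult_left_mono mean_contraction) auto
  also have "\<dots> = ennreal (c ^ Suc n * \<bar>x - x'\<bar>)"
    using factor by (simp add: ennreal_mult[symmetric] ac_simps)
  finally show ?case .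
qed

lemma forward_contraction:
  assumes x: "x \<in> S" "x' \<in> S"
  shows "(\<integral>\<^sup>+\<theta>. ennreal \<bar>forward F \<theta> n x - forward F \<theta> n x'\<bar> \<partial>W n) \<le> ennreal (c ^ n * \<bar>x - x'\<bar>)"
proof (induction n)
  case 0
  have "emeasure (W 0) (space (W 0)) = 1" by (rule W.P.emeasure_space_1)
  then show ?case by simp
next
  case (Suc n)
  have "(\<integral>\<^sup>+\<theta>. ennreal \<bar>forward F \<theta> (Suc n) x - forward F \<theta> (Suc n) x'\<bar> \<partial>W (Suc n)) =
      (\<integral>\<^sup>+\<theta>. \<integral>\<^sup>+v. ennreal \<bar>F v (forward F \<theta> n x) - F v (forward F \<theta> n x')\<bar> \<partial>T \<partial>W n)"
    by (subst nn_integral_W_Suc(2)) (measurable, simp add: forward_fun_upd)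
  also have "\<dots> \<le> (\<integral>\<^sup>+\<theta>. ennreal (c * \<bar>forward F \<theta> n x - forward F \<theta> n x'\<bar>) \<partial>W n)"
    using x by (intro nn_integral_mono mean_contraction forward_in_S) (auto simp: space_W)
  also have "\<dots> = ennreal c * (\<integral>\<^sup>+\<theta>. ennreal \<bar>forward F \<theta> n x - forward F \<theta> n x'\<bar> \<partial>W n)"
    using factor by (subst nn_integral_cmult[symmetric]) (measurable, simp add: ennreal_mult)
  also have "\<dots> \<le> ennreal c * ennreal (c ^ n * \<bar>x - x'\<bar>)"
    by (intro mult_left_mono Suc.IH) auto
  also have "\<dots> = ennreal (c ^ Suc n * \<bar>x - x'\<bar>)"
    using factor by (simp add: ennreal_mult[symmetric] ac_simps)
  finally show ?case .
qed

text \<open>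
  Given the last driving variable \<open>v\<close>, an increment of the backward process compares the same \<open>n\<close>
  maps at the starting points \<open>F v x\<close> and \<open>x\<close>.
\<close>

lemma backward_increment:
  assumes x: "x \<in> S"
  shows "(\<integral>\<^sup>+\<theta>. ennreal \<bar>backward F \<theta> (Suc n) x - backward F \<theta> n x\<bar> \<partial>W (Suc n))
    \<le> ennreal (c ^ n) * (\<integral>\<^sup>+v. ennreal \<bar>F v x - x\<bar> \<partial>T)"
proof -
  have "(\<integral>\<^sup>+\<theta>. ennreal \<bar>backward F \<theta> (Suc n) x - backward F \<theta> n x\<bar> \<partial>W (Suc n)) =
      (\<integral>\<^sup>+v. \<integral>\<^sup>+\<theta>. ennreal \<bar>backward F \<theta> n (F v x) - backward F \<theta> n x\<bar> \<partial>W n \<partial>T)"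
    by (subst nn_integral_W_Suc(1)) (measurable, simp add: backward_fun_upd)
  also have "\<dots> \<le> (\<integral>\<^sup>+v. ennreal (c ^ n * \<bar>F v x - x\<bar>) \<partial>T)"
    using x by (intro nn_integral_mono backward_contraction F_in_S) auto
  also have "\<dots> = ennreal (c ^ n) * (\<integral>\<^sup>+v. ennreal \<bar>F v x - x\<bar> \<partial>T)"
    using factor by (subst nn_integral_cmult[symmetric]) (measurable, simp add: ennreal_mult)
  finally show ?thesis .
qed

text \<open>
  The transition operator of the chain, acting on functions.
\<close>

definition averaging :: "(real \<Rightarrow> real) \<Rightarrow> real \<Rightarrow> real" where
  "averaging \<phi> x = (\<integral>u. \<phi> (F u x) \<partial>T)"

lemma averaging_bounded_measurable:
  assumes [measurable]: "\<phi> \<in> borel_measurable borel" and "\<And>x. 0 \<le> \<phi> x" "\<And>x. \<phi> x \<le> 1"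
  shows "averaging \<phi> \<in> borel_measurable borel" "0 \<le> averaging \<phi> x" "averaging \<phi> x \<le> 1"
proof -
  show "averaging \<phi> \<in> borel_measurable borel"
    unfolding averaging_def[abs_def] by measurable
  show "0 \<le> averaging \<phi> x" unfolding averaging_def by (intro integral_nonneg_AE) (simp add: assms)
  have "averaging \<phi> x \<le> (\<integral>u. 1 \<partial>T)"
    unfolding averaging_def
    by (intro integral_mono integrable_const_bound[where B=1]) (auto simp: assms)
  then show "averaging \<phi> x \<le> 1" by (simp add: prob_space)
qed

lemma funpow_averaging:
  assumes "\<phi> \<in> borel_measurable borel" and "\<And>x. 0 \<le> \<phi> x" "\<And>x. \<phi> x \<le> 1"
  shows "(averaging ^^ n) \<phi> \<in> borel_measurable borel"
    and "0 \<le> (averaging ^^ n) \<phi> x" and "(averaging ^^ n) \<phi> x \<le> 1"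
proof -
  have "(averaging ^^ n) \<phi> \<in> borel_measurable borel \<and> (\<forall>x. 0 \<le> (averaging ^^ n) \<phi> x \<and> (averaging ^^ n) \<phi> x \<le> 1)"
    by (induction n) (simp_all add: assms averaging_bounded_measurable)
  then show "(averaging ^^ n) \<phi> \<in> borel_measurable borel"
    and "0 \<le> (averaging ^^ n) \<phi> x" and "(averaging ^^ n) \<phi> x \<le> 1" by auto
qed

text \<open>
  The last map acts first in the backward process, so integrating it out applies the operator once
  more to the function obtained from the other maps.
\<close>

lemma nn_integral_backward:
  assumes \<phi> [measurable]: "\<phi> \<in> borel_measurable borel" and "\<And>x. 0 \<le> \<phi> x" "\<And>x. \<phi> x \<le> 1"
  shows "(\<integral>\<^sup>+\<theta>. ennreal (\<phi> (backward F \<theta> n x)) \<partial>W n) = ennreal ((averaging ^^ n) \<phi> x)"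
proof (induction n arbitrary: x)
  case 0
  have "emeasure (W 0) (space (W 0)) = 1" by (rule W.P.emeasure_space_1)
  then show ?case by simp
next
  case (Suc n)
  note [measurable] = funpow_averaging(1)[OF assms]
  have "(\<integral>\<^sup>+\<theta>. ennreal (\<phi> (backward F \<theta> (Suc n) x)) \<partial>W (Suc n)) =
      (\<integral>\<^sup>+v. \<integral>\<^sup>+\<theta>. ennreal (\<phi> (backward F \<theta> n (F v x))) \<partial>W n \<partial>T)"
    by (subst nn_integral_W_Suc(1)) (measurable, simp add: backward_fun_upd)
  also have "\<dots> = (\<integral>\<^sup>+v. ennreal ((averaging ^^ n) \<phi> (F v x)) \<partial>T)"
    by (intro nn_integral_cong Suc.IH)
  also have "\<dots> = ennreal (averaging ((averaging ^^ n) \<phi>) x)"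
    unfolding averaging_def[of "(averaging ^^ n) \<phi>"]
    by (intro nn_integral_eq_integral integrable_const_bound[where B=1])
      (auto simp: funpow_averaging[OF assms])
  finally show ?case by simp
qed

text \<open>
  Contraction in mean is what makes the averaged function Lipschitz, although \<open>\<phi> (F u x)\<close> may be
  discontinuous in \<open>x\<close> for every \<open>u\<close>.
\<close>

lemma averaging_lipschitz:
  assumes [measurable]: "\<phi> \<in> borel_measurable borel" and b: "\<And>x. 0 \<le> \<phi> x" "\<And>x. \<phi> x \<le> 1"
    and lip: "\<And>x y. \<bar>\<phi> x - \<phi> y\<bar> \<le> L * \<bar>x - y\<bar>" and L: "0 \<le> L"
    and x: "x \<in> S" "x' \<in> S"
  shows "\<bar>averaging \<phi> x - averaging \<phi> x'\<bar> \<le> L * c * \<bar>x - x'\<bar>"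
proof -
  have i: "integrable T (\<lambda>u. \<phi> (F u y))" for y
    by (intro integrable_const_bound[where B=1]) (auto simp: b)
  have d: "integrable T (\<lambda>u. \<bar>F u x - F u x'\<bar>)"
    using mean_contraction[OF x] by (intro integrableI_bounded) (auto simp: less_top[symmetric] top_unique)
  have "averaging \<phi> x - averaging \<phi> x' = (\<integral>u. \<phi> (F u x) - \<phi> (F u x') \<partial>T)"
    unfolding averaging_def by (simp add: i)
  also have "\<bar>\<dots>\<bar> \<le> (\<integral>u. \<bar>\<phi> (F u x) - \<phi> (F u x')\<bar> \<partial>T)"
    by (rule integral_abs_bound)
  also have "\<dots> \<le> (\<integral>u. L * \<bar>F u x - F u x'\<bar> \<partial>T)"
    using d i lip by (intro integral_mono) auto
  also have "\<dots> = L * (\<integral>u. \<bar>F u x - F u x'\<bar> \<partial>T)" by simp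
  also have "(\<integral>u. \<bar>F u x - F u x'\<bar> \<partial>T) \<le> c * \<bar>x - x'\<bar>"
    using mean_contraction[OF x] d factor by (simp add: nn_integral_eq_integral)
  finally show ?thesis using L by (simp add: mult_left_mono mult.assoc)
qed

end

section \<open>The backward limit and the stationary law\<close>

context mean_contracting_maps
begin

text \<open>
  Invariance is expressed by the law of one step \<open>F u x\<close> with \<open>x\<close> and \<open>u\<close> independent, which avoids
  speaking of the kernel.
\<close>

definition stationary :: "real measure \<Rightarrow> bool" where
  "stationary \<pi> \<longleftrightarrow> prob_space \<pi> \<and> sets \<pi> = sets borel \<and> (AE x in \<pi>. x \<in> S) \<and>
     distr (\<pi> \<Otimes>\<^sub>M T) borel (\<lambda>(x, u). F u x) = \<pi>"

lemma integral_stationary: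
  assumes \<pi>: "prob_space \<pi>" "sets \<pi> = sets borel"
    and \<phi> [measurable]: "\<phi> \<in> borel_measurable borel" and b: "\<And>x. 0 \<le> \<phi> x" "\<And>x. \<phi> x \<le> 1"
  shows "integral\<^sup>L (distr (\<pi> \<Otimes>\<^sub>M T) borel (\<lambda>(x, u). F u x)) \<phi> = (\<integral>x. averaging \<phi> x \<partial>\<pi>)"
proof -
  interpret \<pi>: prob_space \<pi> by fact
  interpret \<pi>T: pair_prob_space \<pi> T ..
  note [measurable_cong] = \<pi>(2)
  have "integral\<^sup>L (distr (\<pi> \<Otimes>\<^sub>M T) borel (\<lambda>(x, u). F u x)) \<phi> = (\<integral>(x, u). \<phi> (F u x) \<partial>(\<pi> \<Otimes>\<^sub>M T))"
    by (subst integral_distr) (simp_all add: case_prod_unfold)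
  also have "\<dots> = (\<integral>x. \<integral>u. \<phi> (F u x) \<partial>T \<partial>\<pi>)"
    by (rule \<pi>T.integral_fst'[symmetric, of "\<lambda>(x, u). \<phi> (F u x)", simplified])
      (intro \<pi>T.integrable_const_bound[where B=1], auto simp: b)
  finally show ?thesis unfolding averaging_def .
qed

lemma averaging_cts_step_continuous:
  assumes "s < t"
  shows "continuous_on S (averaging (cts_step s t))"
proof (rule lipschitz_on_continuous_on, rule lipschitz_onI)
  show "dist (averaging (cts_step s t) x) (averaging (cts_step s t) y) \<le> (1 / (t - s) * c) * dist x y"
    if "x \<in> S" "y \<in> S" for x y
    using averaging_lipschitz[of "cts_step s t" "1 / (t - s)" x y] that assms
      cts_step_lipschitz[OF assms] borel_measurable_cts_step cts_step_bounds[OF assms]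
    by (simp add: dist_real_def)
  show "0 \<le> 1 / (t - s) * c" using assms factor by simp
qed

end

text \<open>
  The maps are driven by random variables on some probability space \<open>N\<close>. Independence and
  identical distribution enter only through the joint laws of initial segments.
\<close>

locale driven_contracting_maps = mean_contracting_maps T F S c + N: prob_space N
  for T :: "'t measure" and F :: "'t \<Rightarrow> real \<Rightarrow> real" and S :: "real set" and c :: real
    and N :: "'b measure" +
  fixes U :: "nat \<Rightarrow> 'b \<Rightarrow> 't"
  assumes U_measurable: "\<And>t. 1 \<le> t \<Longrightarrow> U t \<in> N \<rightarrow>\<^sub>M T"
    and U_law: "\<And>n. distr N (W n) (\<lambda>\<omega>. \<lambda>t\<in>{1..n}. U t \<omega>) = W n"
begin

abbreviation Z :: "nat \<Rightarrow> real \<Rightarrow> 'b \<Rightarrow> real" where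
  "Z n x \<omega> \<equiv> backward F (\<lambda>t. U t \<omega>) n x"

lemma Z_measurable [measurable]: "Z n x \<in> borel_measurable N"
  by (rule measurable_backward) (simp_all add: U_measurable)

lemma Z_in_S: "\<omega> \<in> space N \<Longrightarrow> x \<in> S \<Longrightarrow> Z n x \<omega> \<in> S"
  by (rule backward_in_S) (auto intro: measurable_space[OF U_measurable])

lemma Z_restrict: "m \<le> n \<Longrightarrow> Z m x \<omega> = backward F (\<lambda>t\<in>{1..n}. U t \<omega>) m x"
  by (rule backward_cong_on[where S=UNIV]) auto

lemma nn_integral_U:
  assumes "f \<in> borel_measurable (W n)"
  shows "(\<integral>\<^sup>+\<omega>. f (\<lambda>t\<in>{1..n}. U t \<omega>) \<partial>N) = integral\<^sup>N (W n) f"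
proof -
  have "(\<lambda>\<omega>. \<lambda>t\<in>{1..n}. U t \<omega>) \<in> N \<rightarrow>\<^sub>M W n"
    by (rule measurable_restrict) (simp add: U_measurable)
  then have "integral\<^sup>N (distr N (W n) (\<lambda>\<omega>. \<lambda>t\<in>{1..n}. U t \<omega>)) f = (\<integral>\<^sup>+\<omega>. f (\<lambda>t\<in>{1..n}. U t \<omega>) \<partial>N)"
    by (rule nn_integral_distr) (simp only: measurable_distr_eq1 assms)
  then show ?thesis by (simp only: U_law)
qed

lemma Z_increment:
  assumes x: "x \<in> S"
  shows "(\<integral>\<^sup>+\<omega>. ennreal \<bar>Z (Suc n) x \<omega> - Z n x \<omega>\<bar> \<partial>N) \<le> ennreal (enn2real (\<integral>\<^sup>+v. ennreal \<bar>F v x - x\<bar> \<partial>T) * c ^ n)"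
proof -
  have "(\<integral>\<^sup>+\<omega>. ennreal \<bar>Z (Suc n) x \<omega> - Z n x \<omega>\<bar> \<partial>N) =
      (\<integral>\<^sup>+\<theta>. ennreal \<bar>backward F \<theta> (Suc n) x - backward F \<theta> n x\<bar> \<partial>W (Suc n))"
    unfolding Z_restrict[where m="Suc n" and n="Suc n", OF order_refl] Z_restrict[where m=n and n="Suc n", OF le_SucI[OF order_refl]]
    by (rule nn_integral_U) (intro measurable_compose[OF _ measurable_ennreal] borel_measurable_abs borel_measurable_diff measurable_backward_W, simp_all)
  also have "\<dots> \<le> ennreal (c ^ n) * (\<integral>\<^sup>+v. ennreal \<bar>F v x - x\<bar> \<partial>T)"
    by (rule backward_increment[OF x])
  also have "(\<integral>\<^sup>+v. ennreal \<bar>F v x - x\<bar> \<partial>T) = ennreal (enn2real (\<integral>\<^sup>+v. ennreal \<bar>F v x - x\<bar> \<partial>T))"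
    using mean_displacement[OF x] by (intro ennreal_enn2real[symmetric]) simp
  finally show ?thesis using factor by (simp add: ennreal_mult[symmetric] mult.commute)
qed

lemma Z_difference:
  assumes "x \<in> S" "x' \<in> S"
  shows "(\<integral>\<^sup>+\<omega>. ennreal \<bar>Z n x \<omega> - Z n x' \<omega>\<bar> \<partial>N) \<le> ennreal (\<bar>x - x'\<bar> * c ^ n)"
proof -
  have "(\<integral>\<^sup>+\<omega>. ennreal \<bar>Z n x \<omega> - Z n x' \<omega>\<bar> \<partial>N) =
      (\<integral>\<^sup>+\<theta>. ennreal \<bar>backward F \<theta> n x - backward F \<theta> n x'\<bar> \<partial>W n)"
    unfolding Z_restrict[OF order_refl]
    by (rule nn_integral_U) measurable
  also have "\<dots> \<le> ennreal (c ^ n * \<bar>x - x'\<bar>)" by (rule backward_contraction[OF assms])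
  finally show ?thesis by (simp add: mult.commute)
qed

text \<open>
  The increments of the backward process are absolutely summable because their means are bounded by
  a geometric sequence. This gives the limit for one starting point, and its integrability. Two
  backward processes differ by a sequence whose means are also geometrically bounded, so they have
  the same limit.
\<close>

lemma backward_limit_exists:
  obtains L where "L \<in> borel_measurable N"
    "\<And>x. x \<in> S \<Longrightarrow> AE \<omega> in N. (\<lambda>n. Z n x \<omega>) \<longlonglongrightarrow> L \<omega>"
    "AE \<omega> in N. L \<omega> \<in> S" "integrable N L"
proof -
  obtain x\<^sub>0 where x\<^sub>0: "x\<^sub>0 \<in> S" using S_nonempty by auto
  define L where "L = (\<lambda>\<omega>. lim (\<lambda>n. Z n x\<^sub>0 \<omega>))"
  have meas [measurable]: "L \<in> borel_measurable N"
    unfolding L_def by (rule borel_measurable_lim_metric) simp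
  define K where "K = enn2real (\<integral>\<^sup>+v. ennreal \<bar>F v x\<^sub>0 - x\<^sub>0\<bar> \<partial>T)"
  have incr: "AE \<omega> in N. summable (\<lambda>n. \<bar>Z (Suc n) x\<^sub>0 \<omega> - Z n x\<^sub>0 \<omega>\<bar>)"
    "integrable N (\<lambda>\<omega>. \<Sum>n. \<bar>Z (Suc n) x\<^sub>0 \<omega> - Z n x\<^sub>0 \<omega>\<bar>)"
    using Z_increment[OF x\<^sub>0] factor
    by (intro AE_summable_geometric[of "\<lambda>n \<omega>. Z (Suc n) x\<^sub>0 \<omega> - Z n x\<^sub>0 \<omega>" N K c];
      (simp add: K_def del: backward.simps)?)+
  have conv: "(\<lambda>n. Z n x\<^sub>0 \<omega>) \<longlonglongrightarrow> L \<omega>"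
    and near: "\<bar>L \<omega> - x\<^sub>0\<bar> \<le> (\<Sum>n. \<bar>Z (Suc n) x\<^sub>0 \<omega> - Z n x\<^sub>0 \<omega>\<bar>)"
    if s: "summable (\<lambda>n. \<bar>Z (Suc n) x\<^sub>0 \<omega> - Z n x\<^sub>0 \<omega>\<bar>)" for \<omega>
  proof -
    have telescope: "Z 0 x\<^sub>0 \<omega> + (\<Sum>i<n. Z (Suc i) x\<^sub>0 \<omega> - Z i x\<^sub>0 \<omega>) = Z n x\<^sub>0 \<omega>" for n
      using sum_lessThan_telescope[of "\<lambda>i. Z i x\<^sub>0 \<omega>" n] by linarith
    have "(\<lambda>n. Z 0 x\<^sub>0 \<omega> + (\<Sum>i<n. Z (Suc i) x\<^sub>0 \<omega> - Z i x\<^sub>0 \<omega>)) \<longlonglongrightarrow>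
        Z 0 x\<^sub>0 \<omega> + (\<Sum>i. Z (Suc i) x\<^sub>0 \<omega> - Z i x\<^sub>0 \<omega>)"
      by (intro tendsto_add tendsto_const summable_LIMSEQ summable_rabs_cancel[OF s])
    then have lim: "(\<lambda>n. Z n x\<^sub>0 \<omega>) \<longlonglongrightarrow> Z 0 x\<^sub>0 \<omega> + (\<Sum>i. Z (Suc i) x\<^sub>0 \<omega> - Z i x\<^sub>0 \<omega>)"
      unfolding telescope .
    then have eq: "L \<omega> = Z 0 x\<^sub>0 \<omega> + (\<Sum>i. Z (Suc i) x\<^sub>0 \<omega> - Z i x\<^sub>0 \<omega>)"
      unfolding L_def by (rule limI)
    with lim show "(\<lambda>n. Z n x\<^sub>0 \<omega>) \<longlonglongrightarrow> L \<omega>" by simp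
    have "L \<omega> - x\<^sub>0 = (\<Sum>i. Z (Suc i) x\<^sub>0 \<omega> - Z i x\<^sub>0 \<omega>)"
      unfolding eq by (simp del: backward.simps(2))
    then show "\<bar>L \<omega> - x\<^sub>0\<bar> \<le> (\<Sum>n. \<bar>Z (Suc n) x\<^sub>0 \<omega> - Z n x\<^sub>0 \<omega>\<bar>)"
      using summable_rabs[OF s] by (simp only:)
  qed
  have conv_AE: "AE \<omega> in N. (\<lambda>n. Z n x\<^sub>0 \<omega>) \<longlonglongrightarrow> L \<omega>"
    using incr(1) by eventually_elim (rule conv)
  show ?thesis
  proof (rule that[OF meas])
    fix x assume x: "x \<in> S"
    have "AE \<omega> in N. summable (\<lambda>n. \<bar>Z n x \<omega> - Z n x\<^sub>0 \<omega>\<bar>)"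
      by (rule AE_summable_geometric(1)[OF _ Z_difference[OF x x\<^sub>0] factor]) simp_all
    then show "AE \<omega> in N. (\<lambda>n. Z n x \<omega>) \<longlonglongrightarrow> L \<omega>"
      using conv_AE
    proof eventually_elim
      case (elim \<omega>)
      have "(\<lambda>n. Z n x \<omega> - Z n x\<^sub>0 \<omega>) \<longlonglongrightarrow> 0"
        using summable_LIMSEQ_zero[OF elim(1)] by (rule tendsto_rabs_zero_cancel)
      from tendsto_add[OF this elim(2)] show ?case by simp
    qed
  next
    show "AE \<omega> in N. L \<omega> \<in> S"
      using conv_AE AE_space
    proof eventually_elim
      case (elim \<omega>)
      show ?case
        by (rule closed_sequentially[OF closed_S _ elim(1)]) (rule Z_in_S[OF elim(2) x\<^sub>0])
    qed
  next
    have "integrable N (\<lambda>\<omega>. L \<omega> - x\<^sub>0)"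
    proof (rule Bochner_Integration.integrable_bound[OF incr(2)])
      show "AE \<omega> in N. norm (L \<omega> - x\<^sub>0) \<le> norm (\<Sum>n. \<bar>Z (Suc n) x\<^sub>0 \<omega> - Z n x\<^sub>0 \<omega>\<bar>)"
        using incr(1)
      proof eventually_elim
        case (elim \<omega>)
        from near[OF elim] show ?case unfolding real_norm_def by linarith
      qed
    qed simp
    from Bochner_Integration.integrable_add[OF this N.integrable_const[of x\<^sub>0]]
    show "integrable N L" by simp
  qed
qed

text \<open>
  The iterates of the operator are expectations over the backward process, which converges almost
  surely; bounded convergence applies. Continuity on \<open>S\<close> suffices since \<open>S\<close> contains the process and
  its limit.
\<close>

lemma averaging_converges:
  assumes L: "L \<in> borel_measurable N" "\<And>x. x \<in> S \<Longrightarrow> AE \<omega> in N. (\<lambda>n. Z n x \<omega>) \<longlonglongrightarrow> L \<omega>"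
      "AE \<omega> in N. L \<omega> \<in> S"
    and \<phi> [measurable]: "\<phi> \<in> borel_measurable borel" and b: "\<And>x. 0 \<le> \<phi> x" "\<And>x. \<phi> x \<le> 1"
    and cont: "continuous_on S \<phi>" and x: "x \<in> S"
  shows "(\<lambda>n. (averaging ^^ n) \<phi> x) \<longlonglongrightarrow> integral\<^sup>L (distr N borel L) \<phi>"
proof -
  have "(averaging ^^ n) \<phi> x = (\<integral>\<omega>. \<phi> (Z n x \<omega>) \<partial>N)" for n
  proof -
    have "(\<integral>\<^sup>+\<omega>. ennreal (\<phi> (Z n x \<omega>)) \<partial>N) = (\<integral>\<^sup>+\<theta>. ennreal (\<phi> (backward F \<theta> n x)) \<partial>W n)"
      unfolding Z_restrict[OF order_refl] by (rule nn_integral_U) measurable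
    also have "\<dots> = ennreal ((averaging ^^ n) \<phi> x)"
      by (rule nn_integral_backward[OF \<phi> b])
    finally show ?thesis
      by (subst integral_eq_nn_integral) (auto simp: b funpow_averaging[OF \<phi> b])
  qed
  moreover have "(\<lambda>n. \<integral>\<omega>. \<phi> (Z n x \<omega>) \<partial>N) \<longlonglongrightarrow> (\<integral>\<omega>. \<phi> (L \<omega>) \<partial>N)"
  proof (rule integral_dominated_convergence[where w="\<lambda>_. 1"])
    show "AE \<omega> in N. (\<lambda>n. \<phi> (Z n x \<omega>)) \<longlonglongrightarrow> \<phi> (L \<omega>)"
      using L(2)[OF x] L(3) AE_space
    proof eventually_elim
      case (elim \<omega>)
      show ?case
        by (rule continuous_on_tendsto_compose[OF cont elim(1,2)]) (simp add: Z_in_S[OF elim(3) x])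
    qed
  qed (use L(1) b in \<open>auto\<close>)
  ultimately show ?thesis using L(1) by (simp add: integral_distr)
qed

text \<open>
  Let \<open>\<phi>\<close> be a Lipschitz test function. The same sequence of iterates at a point converges to the
  integral of \<open>\<phi>\<close> and, after a shift by one, to the integral of \<open>averaging \<phi>\<close>, because \<open>averaging \<phi>\<close> is
  again continuous. The latter is the integral of \<open>\<phi>\<close> against the law after one step.
\<close>

theorem limit_law_stationary:
  assumes L: "L \<in> borel_measurable N" "\<And>x. x \<in> S \<Longrightarrow> AE \<omega> in N. (\<lambda>n. Z n x \<omega>) \<longlonglongrightarrow> L \<omega>"
      "AE \<omega> in N. L \<omega> \<in> S"
  shows "stationary (distr N borel L)"
proof -
  define \<pi> where "\<pi> = distr N borel L"
  interpret \<pi>: prob_space \<pi> unfolding \<pi>_def using L(1) by (rule N.prob_space_distr)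
  interpret \<pi>T: pair_prob_space \<pi> T ..
  have sets_\<pi> [simp, measurable_cong]: "sets \<pi> = sets borel" by (simp add: \<pi>_def)
  obtain x\<^sub>0 where x\<^sub>0: "x\<^sub>0 \<in> S" using S_nonempty by auto
  have "distr (\<pi> \<Otimes>\<^sub>M T) borel (\<lambda>(x, u). F u x) = \<pi>"
  proof (rule measure_eqI_cts_step)
    show "real_distribution (distr (\<pi> \<Otimes>\<^sub>M T) borel (\<lambda>(x, u). F u x))"
      by (rule \<pi>T.real_distribution_distr) measurable
    show "real_distribution \<pi>"
      unfolding \<pi>_def by (rule N.real_distribution_distr[OF L(1)])
    fix s t :: real assume st: "s < t"
    let ?\<phi> = "cts_step s t"
    note \<phi> = borel_measurable_cts_step[of s t] cts_step_bounds[OF st]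
    have cont: "continuous_on S ?\<phi>"
      using cts_step_uniformly_continuous[OF st] uniformly_continuous_imp_continuous continuous_on_subset by blast
    have "(\<lambda>n. (averaging ^^ n) (averaging ?\<phi>) x\<^sub>0) \<longlonglongrightarrow> integral\<^sup>L \<pi> (averaging ?\<phi>)"
      unfolding \<pi>_def
      by (rule averaging_converges[OF L averaging_bounded_measurable[OF \<phi>] averaging_cts_step_continuous[OF st] x\<^sub>0])
    then have "(\<lambda>n. (averaging ^^ Suc n) ?\<phi> x\<^sub>0) \<longlonglongrightarrow> integral\<^sup>L \<pi> (averaging ?\<phi>)"
      by (simp add: funpow_swap1)
    moreover have "(\<lambda>n. (averaging ^^ Suc n) ?\<phi> x\<^sub>0) \<longlonglongrightarrow> integral\<^sup>L \<pi> ?\<phi>"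
      unfolding \<pi>_def by (rule LIMSEQ_Suc[OF averaging_converges[OF L \<phi> cont x\<^sub>0]])
    ultimately have "integral\<^sup>L \<pi> (averaging ?\<phi>) = integral\<^sup>L \<pi> ?\<phi>" by (rule LIMSEQ_unique)
    then show "integral\<^sup>L (distr (\<pi> \<Otimes>\<^sub>M T) borel (\<lambda>(x, u). F u x)) ?\<phi> = integral\<^sup>L \<pi> ?\<phi>"
      using integral_stationary[OF \<pi>.prob_space_axioms sets_\<pi> \<phi>] by simp
  qed
  moreover have "AE x in \<pi>. x \<in> S"
    unfolding \<pi>_def using L(1,3) closed_S by (subst AE_distr_iff) auto
  ultimately show ?thesis
    using \<pi>.prob_space_axioms by (simp add: stationary_def flip: \<pi>_def)
qed

text \<open>
  A stationary law gives all iterates of the operator on a test function the same integral, whereas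
  the iterates converge pointwise on \<open>S\<close> to a constant.
\<close>

theorem stationary_unique:
  assumes L: "L \<in> borel_measurable N" "\<And>x. x \<in> S \<Longrightarrow> AE \<omega> in N. (\<lambda>n. Z n x \<omega>) \<longlonglongrightarrow> L \<omega>"
      "AE \<omega> in N. L \<omega> \<in> S"
    and \<pi>': "stationary \<pi>'"
  shows "\<pi>' = distr N borel L"
proof (rule measure_eqI_cts_step)
  interpret \<pi>': prob_space \<pi>' using \<pi>' by (simp add: stationary_def)
  have sets_\<pi>' [simp, measurable_cong]: "sets \<pi>' = sets borel" using \<pi>' by (simp add: stationary_def)
  have space_\<pi>': "space \<pi>' = UNIV" using sets_eq_imp_space_eq[OF sets_\<pi>'] by simp
  show "real_distribution \<pi>'"
    unfolding real_distribution_def real_distribution_axioms_def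
    by (simp add: \<pi>'.prob_space_axioms space_\<pi>')
  show "real_distribution (distr N borel L)" by (rule N.real_distribution_distr[OF L(1)])
  fix s t :: real assume st: "s < t"
  let ?\<phi> = "cts_step s t"
  note \<phi> = borel_measurable_cts_step[of s t] cts_step_bounds[OF st]
  have cont: "continuous_on S ?\<phi>"
    using cts_step_uniformly_continuous[OF st] uniformly_continuous_imp_continuous continuous_on_subset by blast
  have iter: "(\<integral>x. (averaging ^^ n) ?\<phi> x \<partial>\<pi>') = integral\<^sup>L \<pi>' ?\<phi>" for n
  proof (induction n)
    case (Suc n)
    have "integral\<^sup>L \<pi>' ((averaging ^^ n) ?\<phi>) = (\<integral>x. averaging ((averaging ^^ n) ?\<phi>) x \<partial>\<pi>')"
      using integral_stationary[OF \<pi>'.prob_space_axioms sets_\<pi>' funpow_averaging[OF \<phi>]] \<pi>'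
      by (simp add: stationary_def)
    with Suc show ?case by simp
  qed simp
  have "(\<lambda>n. \<integral>x. (averaging ^^ n) ?\<phi> x \<partial>\<pi>') \<longlonglongrightarrow> (\<integral>x. integral\<^sup>L (distr N borel L) ?\<phi> \<partial>\<pi>')"
  proof (rule integral_dominated_convergence[where w="\<lambda>_. 1"])
    show "AE x in \<pi>'. (\<lambda>n. (averaging ^^ n) ?\<phi> x) \<longlonglongrightarrow> integral\<^sup>L (distr N borel L) ?\<phi>"
      using \<pi>' averaging_converges[OF L \<phi> cont] unfolding stationary_def by (auto elim: AE_mp)
    show "AE x in \<pi>'. norm ((averaging ^^ n) ?\<phi> x) \<le> 1" for n
      using funpow_averaging(2,3)[OF \<phi>] by simp
  qed (use funpow_averaging(1)[OF \<phi>] in simp_all)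
  then show "integral\<^sup>L \<pi>' ?\<phi> = integral\<^sup>L (distr N borel L) ?\<phi>"
    unfolding iter using \<pi>'.prob_space by (simp add: LIMSEQ_const_iff)
qed

end

context mean_contracting_maps
begin

text \<open>
  Integrate \<open>c ^ n \<bar>w - w'\<bar> \<le> c ^ n (\<bar>w\<bar> + \<bar>w'\<bar>)\<close> over both starting points.
\<close>

lemma stationary_pair_contraction:
  assumes \<pi>: "prob_space \<pi>" "sets \<pi> = sets borel" "AE x in \<pi>. x \<in> S" "integrable \<pi> (\<lambda>x. x)"
  shows "(\<integral>\<^sup>+(w, w', \<theta>). ennreal \<bar>forward F \<theta> n w - forward F \<theta> n w'\<bar>
           \<partial>(\<pi> \<Otimes>\<^sub>M (\<pi> \<Otimes>\<^sub>M (\<Pi>\<^sub>M t\<in>{1::nat..}. T)))) \<le> ennreal (2 * (\<integral>x. \<bar>x\<bar> \<partial>\<pi>) * c ^ n)"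
proof -
  define D where "D = (\<Pi>\<^sub>M t\<in>{1::nat..}. T)"
  interpret \<pi>: prob_space \<pi> by fact
  interpret D: prob_space D unfolding D_def by (rule W.P.prob_space_axioms)
  interpret \<pi>D: pair_prob_space \<pi> D ..
  note [measurable_cong] = \<pi>(2)
  have comp: "(\<lambda>\<theta>. \<theta> t) \<in> D \<rightarrow>\<^sub>M T" if "1 \<le> t" for t
    unfolding D_def using that by (intro measurable_component_singleton) simp
  have meas: "(\<lambda>z. ennreal \<bar>forward F (snd (snd z)) n (fst z) - forward F (snd (snd z)) n (fst (snd z))\<bar>)
      \<in> borel_measurable (\<pi> \<Otimes>\<^sub>M (\<pi> \<Otimes>\<^sub>M D))"
  proof -
    have "(\<lambda>z. forward F (\<lambda>t. snd (snd z) t) n (fst z)) \<in> borel_measurable (\<pi> \<Otimes>\<^sub>M (\<pi> \<Otimes>\<^sub>M D))"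
      by (rule measurable_forward) (auto intro!: measurable_compose[OF _ comp])
    moreover have "(\<lambda>z. forward F (\<lambda>t. snd (snd z) t) n (fst (snd z))) \<in> borel_measurable (\<pi> \<Otimes>\<^sub>M (\<pi> \<Otimes>\<^sub>M D))"
      by (rule measurable_forward) (auto intro!: measurable_compose[OF _ comp])
    ultimately show ?thesis by measurable
  qed
  have meas2: "(\<lambda>z. ennreal \<bar>forward F (snd z) n w - forward F (snd z) n (fst z)\<bar>)
      \<in> borel_measurable (\<pi> \<Otimes>\<^sub>M D)" for w
  proof -
    have "(\<lambda>z. forward F (\<lambda>t. snd z t) n w) \<in> borel_measurable (\<pi> \<Otimes>\<^sub>M D)"
      by (rule measurable_forward) (auto intro!: measurable_compose[OF _ comp])
    moreover have "(\<lambda>z. forward F (\<lambda>t. snd z t) n (fst z)) \<in> borel_measurable (\<pi> \<Otimes>\<^sub>M D)"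
      by (rule measurable_forward) (auto intro!: measurable_compose[OF _ comp])
    ultimately show ?thesis by measurable
  qed
  have law: "distr D (W n) (\<lambda>\<theta>. restrict \<theta> {1..n}) = W n" for n
    unfolding D_def by (rule W.distr_PiM_restrict_finite) auto
  interpret driven_contracting_maps T F S c D "\<lambda>t \<theta>. \<theta> t"
    by unfold_locales (rule comp, assumption, rule law)
  have inner: "(\<integral>\<^sup>+\<theta>. ennreal \<bar>forward F \<theta> n w - forward F \<theta> n w'\<bar> \<partial>D) \<le> ennreal (c ^ n) * (ennreal \<bar>w\<bar> + ennreal \<bar>w'\<bar>)"
    if "w \<in> S" "w' \<in> S" for w w'
  proof -
    have eq: "forward F \<theta> n x = forward F (\<lambda>t\<in>{1..n}. \<theta> t) n x" for \<theta> :: "nat \<Rightarrow> 't" and x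
      by (rule forward_cong_on[where S=UNIV, THEN conjunct1]) auto
    have "(\<integral>\<^sup>+\<theta>. ennreal \<bar>forward F \<theta> n w - forward F \<theta> n w'\<bar> \<partial>D) =
        (\<integral>\<^sup>+\<theta>. ennreal \<bar>forward F (\<lambda>t\<in>{1..n}. \<theta> t) n w - forward F (\<lambda>t\<in>{1..n}. \<theta> t) n w'\<bar> \<partial>D)"
      by (intro nn_integral_cong) (simp only: eq[symmetric])
    also have "\<dots> = (\<integral>\<^sup>+\<theta>. ennreal \<bar>forward F \<theta> n w - forward F \<theta> n w'\<bar> \<partial>W n)"
      by (rule nn_integral_U[of "\<lambda>\<theta>. ennreal \<bar>forward F \<theta> n w - forward F \<theta> n w'\<bar>"]) measurable
    also have "\<dots> \<le> ennreal (c ^ n * \<bar>w - w'\<bar>)"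
      by (rule forward_contraction[OF that])
    also have "\<dots> \<le> ennreal (c ^ n * (\<bar>w\<bar> + \<bar>w'\<bar>))"
      using factor by (intro ennreal_leI mult_left_mono) auto
    finally show ?thesis using factor by (simp add: ennreal_mult)
  qed
  define m where "m = (\<integral>\<^sup>+x. ennreal \<bar>x\<bar> \<partial>\<pi>)"
  have "(\<integral>\<^sup>+(w, w', \<theta>). ennreal \<bar>forward F \<theta> n w - forward F \<theta> n w'\<bar> \<partial>(\<pi> \<Otimes>\<^sub>M (\<pi> \<Otimes>\<^sub>M D))) =
      (\<integral>\<^sup>+w. \<integral>\<^sup>+z. ennreal \<bar>forward F (snd z) n w - forward F (snd z) n (fst z)\<bar> \<partial>(\<pi> \<Otimes>\<^sub>M D) \<partial>\<pi>)"
    using \<pi>D.P.nn_integral_fst[OF meas] by (simp add: case_prod_unfold)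
  also have "\<dots> = (\<integral>\<^sup>+w. \<integral>\<^sup>+w'. \<integral>\<^sup>+\<theta>. ennreal \<bar>forward F \<theta> n w - forward F \<theta> n w'\<bar> \<partial>D \<partial>\<pi> \<partial>\<pi>)"
    using D.nn_integral_fst[OF meas2] by simp
  also have "\<dots> \<le> (\<integral>\<^sup>+w. \<integral>\<^sup>+w'. ennreal (c ^ n) * (ennreal \<bar>w\<bar> + ennreal \<bar>w'\<bar>) \<partial>\<pi> \<partial>\<pi>)"
  proof (rule nn_integral_mono_AE)
    show "AE w in \<pi>. (\<integral>\<^sup>+w'. \<integral>\<^sup>+\<theta>. ennreal \<bar>forward F \<theta> n w - forward F \<theta> n w'\<bar> \<partial>D \<partial>\<pi>)
        \<le> (\<integral>\<^sup>+w'. ennreal (c ^ n) * (ennreal \<bar>w\<bar> + ennreal \<bar>w'\<bar>) \<partial>\<pi>)"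
      using \<pi>(3)
    proof eventually_elim
      case (elim w)
      show ?case
        using \<pi>(3) by (intro nn_integral_mono_AE, eventually_elim) (rule inner[OF elim])
    qed
  qed
  also have "\<dots> = ennreal (c ^ n) * (m + m)"
    unfolding m_def
    by (simp add: nn_integral_cmult nn_integral_add \<pi>.emeasure_space_1)
  also have "m = ennreal (\<integral>x. \<bar>x\<bar> \<partial>\<pi>)"
    unfolding m_def using \<pi>(4) by (intro nn_integral_eq_integral) auto
  also have "ennreal (c ^ n) * (ennreal (\<integral>x. \<bar>x\<bar> \<partial>\<pi>) + ennreal (\<integral>x. \<bar>x\<bar> \<partial>\<pi>)) = ennreal (2 * (\<integral>x. \<bar>x\<bar> \<partial>\<pi>) * c ^ n)"
    using factor by (simp add: ennreal_mult[symmetric] ennreal_plus[symmetric] algebra_simps del: ennreal_plus)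
  finally show ?thesis unfolding D_def .
qed

end

section \<open>The random maps of an observation-driven model\<close>

text \<open>
  The data of the model that do not refer to a process: an exponential family, a state space inside
  the range of its means, and a Lipschitz recursion.
\<close>

locale observation_model = exponential_family \<mu> A h B \<Theta>
  for \<mu> :: "real measure" and A h B :: "real \<Rightarrow> real" and \<Theta> :: "real set" +
  fixes E S :: "real set" and g :: "real \<Rightarrow> real \<Rightarrow> real" and a b :: real
  assumes observations: "observation_space (ef_law \<mu> A h) \<Theta> E"
    and S_ne: "S \<noteq> {}" and S_nonneg: "S \<subseteq> {0..}" and S_range: "S \<subseteq> B ` \<Theta>"
    and S_complete: "complete S"
    and S_invariant: "\<And>u x. 0 < u \<Longrightarrow> u < 1 \<Longrightarrow> x \<in> S \<Longrightarrow>
      random_map (mean_law \<mu> A h B \<Theta>) g u x \<in> S"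
    and ab: "0 \<le> a" "0 \<le> b" "a + b < 1"
    and lipschitz: "\<And>x x' y y'. 0 \<le> x \<Longrightarrow> 0 \<le> x' \<Longrightarrow> y \<in> E \<Longrightarrow> y' \<in> E \<Longrightarrow>
      \<bar>g x y - g x' y'\<bar> \<le> a * \<bar>x - x'\<bar> + b * \<bar>y - y'\<bar>"
begin

abbreviation Q :: "real \<Rightarrow> real measure" where
  "Q \<equiv> mean_law \<mu> A h B \<Theta>"

lemma mean_law_at_derivative: "\<eta> \<in> \<Theta> \<Longrightarrow> Q (B \<eta>) = law \<eta>"
  unfolding mean_law_def
  by (simp add: inv_into_f_f strict_mono_on_imp_inj_on[OF strict_mono_on_derivative])

lemma parameter_of_mean: "x \<in> S \<Longrightarrow> inv_into \<Theta> B x \<in> \<Theta>" "x \<in> S \<Longrightarrow> B (inv_into \<Theta> B x) = x"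
  using S_range by (auto intro: inv_into_into f_inv_into_f)

lemma real_distribution_Q: "x \<in> S \<Longrightarrow> real_distribution (Q x)"
  unfolding mean_law_def by (intro real_distribution_law parameter_of_mean)

lemma AE_Q_nonneg: "AE y in Q x. 0 \<le> y"
  unfolding mean_law_def by (rule AE_law_nonneg)

lemma integrable_Q: "x \<in> S \<Longrightarrow> integrable (Q x) (\<lambda>y. y)"
  unfolding mean_law_def by (intro integrable_law_id parameter_of_mean)

lemma integral_Q: "x \<in> S \<Longrightarrow> integral\<^sup>L (Q x) (\<lambda>y. y) = x"
  unfolding mean_law_def by (simp add: mean_eq_derivative parameter_of_mean)

lemma cdf_Q_antimono:
  assumes "x \<in> S" "x' \<in> S" "x \<le> x'"
  shows "cdf (Q x') t \<le> cdf (Q x) t"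
  unfolding mean_law_def
proof (rule cdf_law_antimono)
  show "inv_into \<Theta> B x \<le> inv_into \<Theta> B x'"
    using assms parameter_of_mean strict_mono_on_leD[OF strict_mono_on_derivative]
      strict_mono_onD[OF strict_mono_on_derivative, of "inv_into \<Theta> B x'" "inv_into \<Theta> B x"]
    by (metis not_le)
qed (use assms parameter_of_mean in auto)

lemma E_nonneg: "E \<subseteq> {0..}" and E_closed: "closed E" and zero_in_E: "0 \<in> E"
  using observations unfolding observation_space_def by (auto elim: Nats_cases)

lemma E_borel [measurable]: "E \<in> sets borel"
  using E_closed by (rule borel_closed)

lemma S_closed: "closed S"
  using S_complete by (rule complete_imp_closed)

lemma S_borel [measurable]: "S \<in> sets borel"
  using S_closed by (rule borel_closed)

text \<open>
  The observation produced from state \<open>x\<close> by a uniform variable. The value \<open>0\<close> off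
  \<open>S \<times> (0,1)\<close> belongs to \<open>E\<close>, so that \<open>q\<close> is always a possible observation.
\<close>

definition q :: "real \<Rightarrow> real \<Rightarrow> real" where
  "q x u = (if x \<in> S \<and> u \<in> {0<..<1} then quantile (Q x) u else 0)"

lemma q_in_E: "q x u \<in> E"
proof (cases "x \<in> S \<and> u \<in> {0<..<1}")
  case True
  note L = real_distribution_Q[of x] AE_Q_nonneg[of x]
  show ?thesis
  proof (cases "E = {0..}")
    case E: True
    then show ?thesis using True quantile_nonneg[OF L, of u] by (simp add: q_def)
  next
    case False
    then have "E = \<nat>" "AE y in Q x. y \<in> \<nat>"
      using observations True parameter_of_mean(1)[of x] unfolding observation_space_def mean_law_def by auto
    then show ?thesis using True quantile_in_Nats[OF L, of u] by (simp add: q_def)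
  qed
next
  case False
  then show ?thesis using zero_in_E by (auto simp: q_def)
qed

lemma q_nonneg: "0 \<le> q x u"
  using q_in_E E_nonneg by auto

lemma q_mono:
  assumes "x \<in> S" "x' \<in> S" "x \<le> x'"
  shows "q x u \<le> q x' u"
  using assms quantile_antimono_cdf[OF real_distribution_Q AE_Q_nonneg real_distribution_Q AE_Q_nonneg cdf_Q_antimono, of x x' u]
  by (auto simp: q_def)

text \<open>
  A sublevel set of \<open>q\<close> is given by a condition \<open>u \<le> G x\<close>, where \<open>G\<close> is the value at a fixed point of
  the distribution function with mean \<open>x\<close>. By stochastic order \<open>G\<close> is
  decreasing on \<open>S\<close>, hence measurable.
\<close>

lemma q_measurable: "(\<lambda>(x, u). q x u) \<in> borel_measurable (borel \<Otimes>\<^sub>M borel)"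
proof (rule borel_measurableI_le)
  fix t :: real
  define G where "G = (\<lambda>x. if x \<in> S then cdf (Q x) t else 0)"
  have "mono_on S (\<lambda>x. - cdf (Q x) t)"
    by (rule mono_onI) (simp add: cdf_Q_antimono)
  then have "(\<lambda>x. - cdf (Q x) t) \<in> borel_measurable (restrict_space borel S)"
    by (rule borel_measurable_mono_on_fnc)
  then have "(\<lambda>x. - (- cdf (Q x) t)) \<in> borel_measurable (restrict_space borel S)"
    by (rule borel_measurable_uminus)
  then have [measurable]: "G \<in> borel_measurable borel"
    unfolding G_def by (subst measurable_If_restrict_space_iff) simp_all
  have "q x u \<le> t \<longleftrightarrow> 0 \<le> t \<and> (x \<in> S \<longrightarrow> u \<in> {0<..<1} \<longrightarrow> u \<le> G x)" for x u
  proof (cases "x \<in> S \<and> u \<in> {0<..<1}")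
    case True
    then show ?thesis
      using quantile_le_iff[OF real_distribution_Q AE_Q_nonneg, of x u t] q_nonneg[of x u]
      by (auto simp: q_def G_def)
  qed (auto simp: q_def)
  then have "{z \<in> space (borel \<Otimes>\<^sub>M borel). (case z of (x, u) \<Rightarrow> q x u) \<le> t} =
      {z \<in> space (borel \<Otimes>\<^sub>M borel). 0 \<le> t \<and> (fst z \<in> S \<longrightarrow> snd z \<in> {0<..<1} \<longrightarrow> snd z \<le> G (fst z))}"
    by (simp add: case_prod_unfold)
  also have "\<dots> \<in> sets (borel \<Otimes>\<^sub>M borel)"
    unfolding greaterThanLessThan_iff by measurable
  finally show "{z \<in> space (borel \<Otimes>\<^sub>M borel). (case z of (x, u) \<Rightarrow> q x u) \<le> t} \<in> sets (borel \<Otimes>\<^sub>M borel)" .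
qed

lemma measurable_q [measurable (raw)]:
  "X \<in> borel_measurable N \<Longrightarrow> V \<in> borel_measurable N \<Longrightarrow> (\<lambda>\<omega>. q (X \<omega>) (V \<omega>)) \<in> borel_measurable N"
  using measurable_compose[OF measurable_Pair q_measurable, of X N V] by simp

lemma distr_q: "x \<in> S \<Longrightarrow> distr uniform01 borel (q x) = Q x"
  using distr_quantile[OF real_distribution_Q AE_Q_nonneg, of x] by (simp add: q_def[abs_def])

lemma integrable_q: "x \<in> S \<Longrightarrow> integrable uniform01 (q x)"
  and integral_q: "x \<in> S \<Longrightarrow> integral\<^sup>L uniform01 (q x) = x"
proof -
  assume x: "x \<in> S"
  have q: "q x \<in> uniform01 \<rightarrow>\<^sub>M borel" by measurable
  have "integrable (distr uniform01 borel (q x)) (\<lambda>y. y)"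
    unfolding distr_q[OF x] by (rule integrable_Q[OF x])
  then show "integrable uniform01 (q x)" by (rule integrable_distr[OF q])
  have "integral\<^sup>L (distr uniform01 borel (q x)) (\<lambda>y. y) = integral\<^sup>L uniform01 (q x)"
    by (rule integral_distr[OF q]) simp
  then show "integral\<^sup>L uniform01 (q x) = x" unfolding distr_q[OF x] integral_Q[OF x] by simp
qed

text \<open>
  By stochastic order the difference \<open>q x' u - q x u\<close> has the same sign for all \<open>u\<close>, so the absolute
  value may be taken after integration.
\<close>

lemma mean_distance_q:
  assumes "x \<in> S" "x' \<in> S"
  shows "(\<integral>\<^sup>+u. ennreal \<bar>q x u - q x' u\<bar> \<partial>uniform01) = ennreal \<bar>x - x'\<bar>"
proof -
  have *: "(\<integral>\<^sup>+u. ennreal \<bar>q x u - q x' u\<bar> \<partial>uniform01) = ennreal \<bar>x - x'\<bar>"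
    if x: "x \<in> S" "x' \<in> S" "x \<le> x'" for x x'
  proof -
    have "(\<integral>\<^sup>+u. ennreal \<bar>q x u - q x' u\<bar> \<partial>uniform01) = (\<integral>\<^sup>+u. ennreal (q x' u - q x u) \<partial>uniform01)"
      using q_mono[OF x] by (intro nn_integral_cong) (simp add: abs_minus_commute)
    also have "\<dots> = ennreal (\<integral>u. q x' u - q x u \<partial>uniform01)"
      using integrable_q[OF x(1)] integrable_q[OF x(2)] q_mono[OF x]
      by (intro nn_integral_eq_integral) auto
    also have "(\<integral>u. q x' u - q x u \<partial>uniform01) = \<bar>x - x'\<bar>"
      using integrable_q[OF x(1)] integrable_q[OF x(2)] integral_q[OF x(1)] integral_q[OF x(2)] x(3) by simp
    finally show ?thesis .
  qed
  show ?thesis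
    using *[of x x'] *[of x' x] assms by (cases "x \<le> x'") (simp_all add: abs_minus_commute)
qed

text \<open>
  Outside \<open>[0,\<infinity>) \<times> E\<close> the function \<open>g\<close> may fail to be measurable, so it is replaced by \<open>0\<close> there.
\<close>

definition g_ext :: "real \<Rightarrow> real \<Rightarrow> real" where
  "g_ext x y = (if 0 \<le> x \<and> y \<in> E then g x y else 0)"

lemma g_ext_measurable: "(\<lambda>(x, y). g_ext x y) \<in> borel_measurable (borel \<Otimes>\<^sub>M borel)"
proof -
  let ?D = "{0..} \<times> E :: (real \<times> real) set" and ?g = "\<lambda>z. g (fst z) (snd z)"
  have "continuous_on ?D ?g"
  proof (rule lipschitz_on_continuous_on, rule lipschitz_onI)
    fix z z' assume zz: "z \<in> ?D" "z' \<in> ?D"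
    have "dist (?g z) (?g z') \<le> a * \<bar>fst z - fst z'\<bar> + b * \<bar>snd z - snd z'\<bar>"
      using zz lipschitz[of "fst z" "fst z'" "snd z" "snd z'"] by (auto simp: dist_real_def)
    also have "\<dots> \<le> a * dist z z' + b * dist z z'"
      using ab dist_fst_le[of z z'] dist_snd_le[of z z']
      by (intro add_mono mult_left_mono) (auto simp: dist_real_def)
    finally show "dist (?g z) (?g z') \<le> (a + b) * dist z z'" by (simp add: algebra_simps)
  qed (use ab in simp)
  moreover have "?D \<in> sets borel"
    using E_closed by (intro borel_closed closed_Times) auto
  ultimately have "(\<lambda>z. indicator ?D z *\<^sub>R ?g z) \<in> borel_measurable borel"
    by (intro borel_measurable_continuous_on_indicator)
  moreover have "(\<lambda>z. indicator ?D z *\<^sub>R ?g z) = (\<lambda>(x, y). g_ext x y)"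
    by (auto simp: g_ext_def fun_eq_iff split: split_indicator)
  ultimately show ?thesis by (simp add: borel_prod)
qed

lemma measurable_g_ext [measurable (raw)]:
  "X \<in> borel_measurable N \<Longrightarrow> V \<in> borel_measurable N \<Longrightarrow> (\<lambda>\<omega>. g_ext (X \<omega>) (V \<omega>)) \<in> borel_measurable N"
  using measurable_compose[OF measurable_Pair g_ext_measurable, of X N V] by simp

text \<open>
  A jointly measurable version of the random maps with all values in \<open>S\<close>; it differs from them
  only off \<open>S \<times> (0,1)\<close>, where the value is an arbitrary point of \<open>S\<close>.
\<close>

definition F :: "real \<Rightarrow> real \<Rightarrow> real" where
  "F u x = (if x \<in> S \<and> u \<in> {0<..<1} then g_ext x (q x u) else (SOME x. x \<in> S))"

lemma g_ext_eq: "x \<in> S \<Longrightarrow> y \<in> E \<Longrightarrow> g_ext x y = g x y"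
  using S_nonneg by (auto simp: g_ext_def)

lemma F_eq: "x \<in> S \<Longrightarrow> u \<in> {0<..<1} \<Longrightarrow> F u x = random_map Q g u x"
  using g_ext_eq[OF _ q_in_E, of x x u] by (simp add: F_def random_map_def q_def)

lemma F_in: "F u x \<in> S"
proof (cases "x \<in> S \<and> u \<in> {0<..<1}")
  case True
  then show ?thesis using F_eq[of x u] S_invariant[of u x] by simp
next
  case False
  then have "F u x = (SOME x. x \<in> S)" by (auto simp: F_def)
  then show ?thesis using S_ne by (simp add: some_in_eq)
qed

lemma F_eq_g_ext: "x \<in> S \<Longrightarrow> AE u in uniform01. F u x = g_ext x (q x u)"
  using AE_uniform01 by eventually_elim (simp add: F_def)

lemma mean_contraction_F:
  assumes x: "x \<in> S" "x' \<in> S"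
  shows "(\<integral>\<^sup>+u. ennreal \<bar>F u x - F u x'\<bar> \<partial>uniform01) \<le> ennreal ((a + b) * \<bar>x - x'\<bar>)"
proof -
  interpret prob_space uniform01 by (rule prob_space_uniform01)
  have "(\<integral>\<^sup>+u. ennreal \<bar>F u x - F u x'\<bar> \<partial>uniform01) \<le>
      (\<integral>\<^sup>+u. ennreal (a * \<bar>x - x'\<bar>) + ennreal b * ennreal \<bar>q x u - q x' u\<bar> \<partial>uniform01)"
  proof (rule nn_integral_mono_AE)
    show "AE u in uniform01. ennreal \<bar>F u x - F u x'\<bar> \<le>
        ennreal (a * \<bar>x - x'\<bar>) + ennreal b * ennreal \<bar>q x u - q x' u\<bar>"
      using F_eq_g_ext[OF x(1)] F_eq_g_ext[OF x(2)]
    proof eventually_elim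
      case (elim u)
      have "0 \<le> x" "0 \<le> x'" using x S_nonneg by auto
      then have "\<bar>F u x - F u x'\<bar> \<le> a * \<bar>x - x'\<bar> + b * \<bar>q x u - q x' u\<bar>"
        unfolding elim g_ext_eq[OF x(1) q_in_E] g_ext_eq[OF x(2) q_in_E] by (intro lipschitz q_in_E)
      then show ?case
        using ab by (simp add: ennreal_mult[symmetric] ennreal_plus[symmetric] ennreal_leI del: ennreal_plus)
    qed
  qed
  also have "\<dots> = ennreal (a * \<bar>x - x'\<bar>) + ennreal b * ennreal \<bar>x - x'\<bar>"
    by (simp add: nn_integral_add nn_integral_cmult emeasure_space_1[simplified] mean_distance_q[OF x])
  also have "\<dots> = ennreal ((a + b) * \<bar>x - x'\<bar>)"
    using ab by (simp add: ennreal_mult[symmetric] ennreal_plus[symmetric] algebra_simps del: ennreal_plus)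
  finally show ?thesis .
qed

lemma mean_displacement_F:
  assumes x: "x \<in> S"
  shows "(\<integral>\<^sup>+u. ennreal \<bar>F u x - x\<bar> \<partial>uniform01) < \<infinity>"
proof -
  interpret prob_space uniform01 by (rule prob_space_uniform01)
  have "(\<integral>\<^sup>+u. ennreal \<bar>F u x - x\<bar> \<partial>uniform01) \<le> (\<integral>\<^sup>+u. ennreal (\<bar>g x 0\<bar> + \<bar>x\<bar> + b * q x u) \<partial>uniform01)"
  proof (rule nn_integral_mono_AE)
    show "AE u in uniform01. ennreal \<bar>F u x - x\<bar> \<le> ennreal (\<bar>g x 0\<bar> + \<bar>x\<bar> + b * q x u)"
      using F_eq_g_ext[OF x]
    proof eventually_elim
      case (elim u)
      have "0 \<le> x" using x S_nonneg by auto
      then have "\<bar>g x (q x u) - g x 0\<bar> \<le> b * q x u"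
        using lipschitz[of x x "q x u" 0] q_in_E zero_in_E q_nonneg[of x u] by simp
      then show ?case
        unfolding elim g_ext_eq[OF x q_in_E] by (intro ennreal_leI) linarith
    qed
  qed
  also have "\<dots> = ennreal (\<integral>u. \<bar>g x 0\<bar> + \<bar>x\<bar> + b * q x u \<partial>uniform01)"
    using integrable_q[OF x] ab q_nonneg by (intro nn_integral_eq_integral) auto
  also have "\<dots> < \<infinity>" by simp
  finally show ?thesis .
qed

lemma F_measurable_pair: "(\<lambda>(u, x). F u x) \<in> borel_measurable (uniform01 \<Otimes>\<^sub>M borel)"
proof -
  have "(\<lambda>z. F (fst z) (snd z)) \<in> borel_measurable (borel \<Otimes>\<^sub>M borel)"
    unfolding F_def by measurable
  moreover have "borel_measurable (uniform01 \<Otimes>\<^sub>M borel) = borel_measurable (borel \<Otimes>\<^sub>M (borel :: real measure))"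
    by (intro measurable_cong_sets sets_pair_measure_cong) simp_all
  ultimately show ?thesis by (simp add: case_prod_unfold)
qed

sublocale chain: mean_contracting_maps uniform01 F S "a + b"
proof (intro mean_contracting_maps.intro mean_contracting_maps_axioms.intro)
  show "prob_space uniform01" by (rule prob_space_uniform01)
qed (use F_measurable_pair S_closed S_ne F_in ab mean_contraction_F mean_displacement_F in auto)

text \<open>
  Inverse transform sampling identifies the transition kernel with the law of \<open>F u x\<close>.
\<close>

lemma emeasure_transition_kernel:
  assumes x: "x \<in> S" and C: "C \<in> sets borel"
  shows "emeasure (transition_kernel Q E g x) C = emeasure uniform01 {u. F u x \<in> C}"
proof -
  have sets_Q: "sets (Q x) = sets borel" by (simp add: mean_law_def)
  have space_Q: "space (Q x) = UNIV" by (simp add: mean_law_def)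
  have restr: "measurable (restrict_space (Q x) E) borel = measurable (restrict_space borel E) (borel :: real measure)"
    by (intro measurable_cong_sets sets_restrict_space_cong sets_Q refl)
  have g_ext_x: "g_ext x \<in> borel_measurable borel" by measurable
  have "g_ext x \<in> borel_measurable (restrict_space borel E)"
    using g_ext_x by (rule measurable_restrict_space1)
  moreover have "g_ext x y = g x y" if "y \<in> space (restrict_space borel E)" for y
    using that x by (simp add: space_restrict_space g_ext_eq)
  ultimately have "g x \<in> borel_measurable (restrict_space borel E)"
    using measurable_cong[of "restrict_space borel E" "g_ext x" "g x" borel] by blast
  then have g: "g x \<in> borel_measurable (restrict_space (Q x) E)" unfolding restr .
  have q: "q x \<in> uniform01 \<rightarrow>\<^sub>M borel" by measurable
  have "emeasure (transition_kernel Q E g x) C = emeasure (restrict_space (Q x) E) (g x -` C \<inter> space (restrict_space (Q x) E))"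
    unfolding transition_kernel_def by (rule emeasure_distr[OF g C])
  also have "g x -` C \<inter> space (restrict_space (Q x) E) = g_ext x -` C \<inter> E"
    using x by (auto simp: space_restrict_space space_Q g_ext_eq)
  also have "emeasure (restrict_space (Q x) E) (g_ext x -` C \<inter> E) = emeasure (Q x) (g_ext x -` C \<inter> E)"
    by (rule emeasure_restrict_space) (auto simp: sets_Q space_Q)
  also have "\<dots> = emeasure uniform01 (q x -` (g_ext x -` C \<inter> E) \<inter> space uniform01)"
    unfolding distr_q[OF x, symmetric]
    by (rule emeasure_distr[OF q]) (use measurable_sets[OF g_ext_x C] in simp)
  also have "\<dots> = emeasure uniform01 {u. F u x \<in> C}"
  proof (rule emeasure_eq_AE)
    show "AE u in uniform01. (u \<in> q x -` (g_ext x -` C \<inter> E) \<inter> space uniform01) = (u \<in> {u. F u x \<in> C})"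
      using F_eq_g_ext[OF x] by eventually_elim (simp add: q_in_E)
    show "q x -` (g_ext x -` C \<inter> E) \<inter> space uniform01 \<in> sets uniform01"
      by (rule measurable_sets[OF q]) (use measurable_sets[OF g_ext_x C] in simp)
    have "(\<lambda>u. F u x) \<in> borel_measurable uniform01" by measurable
    from measurable_sets[OF this C] show "{u. F u x \<in> C} \<in> sets uniform01" by (simp add: vimage_def)
  qed
  finally show ?thesis .
qed

lemma emeasure_transition_step:
  assumes \<pi>: "prob_space \<pi>" "sets \<pi> = sets borel" and C: "C \<in> sets borel"
  shows "emeasure (distr (\<pi> \<Otimes>\<^sub>M uniform01) borel (\<lambda>(x, u). F u x)) C = (\<integral>\<^sup>+x. emeasure uniform01 {u. F u x \<in> C} \<partial>\<pi>)"
proof -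
  note [measurable_cong] = \<pi>(2)
  have F: "(\<lambda>(x, u). F u x) \<in> borel_measurable (\<pi> \<Otimes>\<^sub>M uniform01)" by measurable
  have "space \<pi> = UNIV" using sets_eq_imp_space_eq[OF \<pi>(2)] by simp
  then have "emeasure (distr (\<pi> \<Otimes>\<^sub>M uniform01) borel (\<lambda>(x, u). F u x)) C =
      emeasure (\<pi> \<Otimes>\<^sub>M uniform01) ((\<lambda>(x, u). F u x) -` C \<inter> space (\<pi> \<Otimes>\<^sub>M uniform01))"
    by (intro emeasure_distr[OF F C])
  also have "\<dots> = (\<integral>\<^sup>+x. emeasure uniform01 (Pair x -` ((\<lambda>(x, u). F u x) -` C \<inter> space (\<pi> \<Otimes>\<^sub>M uniform01))) \<partial>\<pi>)"
    by (rule chain.emeasure_pair_measure_alt) (rule measurable_sets[OF F C])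
  also have "\<dots> = (\<integral>\<^sup>+x. emeasure uniform01 {u. F u x \<in> C} \<partial>\<pi>)"
    by (intro nn_integral_cong arg_cong[where f="emeasure uniform01"]) (auto simp: space_pair_measure)
  finally show ?thesis .
qed

lemma stationary_distribution_iff:
  "stationary_distribution (transition_kernel Q E g) S \<pi> \<longleftrightarrow> chain.stationary \<pi>"
proof -
  have "(\<forall>C\<in>sets borel. emeasure \<pi> C = (\<integral>\<^sup>+x. emeasure (transition_kernel Q E g x) C \<partial>\<pi>)) \<longleftrightarrow>
      distr (\<pi> \<Otimes>\<^sub>M uniform01) borel (\<lambda>(x, u). F u x) = \<pi>"
    if \<pi>: "prob_space \<pi>" "sets \<pi> = sets borel" "AE x in \<pi>. x \<in> S"
  proof -
    have "(\<integral>\<^sup>+x. emeasure (transition_kernel Q E g x) C \<partial>\<pi>) =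
        emeasure (distr (\<pi> \<Otimes>\<^sub>M uniform01) borel (\<lambda>(x, u). F u x)) C" if C: "C \<in> sets borel" for C
      unfolding emeasure_transition_step[OF \<pi>(1,2) C]
      using \<pi>(3) by (intro nn_integral_cong_AE, eventually_elim) (rule emeasure_transition_kernel[OF _ C])
    then show ?thesis
      using \<pi>(2) by (auto intro!: measure_eqI)
  qed
  then show ?thesis unfolding stationary_distribution_def chain.stationary_def by blast
qed

end

section \<open>The observations as a process\<close>

lemma space_observation_algebra [simp]: "space (observation_algebra M \<eta> Y m) = space M"
  unfolding observation_algebra_def by (rule space_measure_of) auto

lemma sets_observation_algebra:
  "sets (observation_algebra M \<eta> Y m) = sigma_sets (space M)
     ({\<eta> 1 -` C \<inter> space M |C. C \<in> sets borel} \<union>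
      {Y s -` C \<inter> space M |s C. 1 \<le> s \<and> s \<le> m \<and> C \<in> sets borel})"
  unfolding observation_algebra_def by (rule sets_measure_of) auto

lemma observation_algebra_mono:
  assumes "m \<le> n"
  shows "sets (observation_algebra M \<eta> Y m) \<subseteq> sets (observation_algebra M \<eta> Y n)"
  unfolding sets_observation_algebra by (rule sigma_sets_mono', rule Un_mono[OF subset_refl]) (use assms le_trans in blast)

lemma measurable_initial_parameter: "\<eta> 1 \<in> borel_measurable (observation_algebra M \<eta> Y m)"
proof (rule measurableI)
  fix C :: "real set" assume "C \<in> sets borel"
  then show "\<eta> 1 -` C \<inter> space (observation_algebra M \<eta> Y m) \<in> sets (observation_algebra M \<eta> Y m)"
    unfolding sets_observation_algebra space_observation_algebra
    by (intro sigma_sets.Basic) blast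
qed simp

lemma measurable_observation:
  assumes "1 \<le> s" "s \<le> m"
  shows "Y s \<in> borel_measurable (observation_algebra M \<eta> Y m)"
proof (rule measurableI)
  fix C :: "real set" assume "C \<in> sets borel"
  then show "Y s -` C \<inter> space (observation_algebra M \<eta> Y m) \<in> sets (observation_algebra M \<eta> Y m)"
    unfolding sets_observation_algebra space_observation_algebra
    using assms by (intro sigma_sets.Basic) blast
qed simp

lemma subalgebra_observation_algebra:
  assumes "\<eta> 1 \<in> borel_measurable M" "\<And>s. 1 \<le> s \<Longrightarrow> Y s \<in> borel_measurable M"
  shows "subalgebra M (observation_algebra M \<eta> Y m)"
  unfolding subalgebra_def sets_observation_algebra
proof (intro conjI sets.sigma_sets_subset)
  show "{\<eta> 1 -` C \<inter> space M |C. C \<in> sets borel} \<union>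
      {Y s -` C \<inter> space M |s C. 1 \<le> s \<and> s \<le> m \<and> C \<in> sets borel} \<subseteq> sets M"
    using assms by (auto intro: measurable_sets)
qed simp

locale observation_process = observation_model \<mu> A h B \<Theta> E S g a b
  for \<mu> :: "real measure" and A h B :: "real \<Rightarrow> real" and \<Theta> E S :: "real set"
    and g :: "real \<Rightarrow> real \<Rightarrow> real" and a b :: real +
  fixes M :: "'w measure" and \<eta> Y :: "nat \<Rightarrow> 'w \<Rightarrow> real"
  assumes model: "observation_driven_model law B \<Theta> g S M \<eta> Y"
begin

abbreviation X :: "nat \<Rightarrow> 'w \<Rightarrow> real" where
  "X t \<omega> \<equiv> B (\<eta> t \<omega>)"

abbreviation past :: "nat \<Rightarrow> 'w measure" where
  "past m \<equiv> observation_algebra M \<eta> Y m"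

sublocale M: prob_space M
  using model by (simp add: observation_driven_model_def)

lemma model_facts:
  assumes "1 \<le> t"
  shows "\<eta> t \<in> borel_measurable M" "Y t \<in> borel_measurable M"
    and "\<omega> \<in> space M \<Longrightarrow> \<eta> t \<omega> \<in> \<Theta>" "\<omega> \<in> space M \<Longrightarrow> X t \<omega> \<in> S"
    and "C \<in> sets borel \<Longrightarrow> AE \<omega> in M.
          real_cond_exp M (past (t - 1)) (indicator (Y t -` C \<inter> space M)) \<omega> = measure (law (\<eta> t \<omega>)) C"
    and "AE \<omega> in M. X (Suc t) \<omega> = g (X t \<omega>) (Y t \<omega>)"
  using model assms unfolding observation_driven_model_def by blast+

lemma X_recursion: "AE \<omega> in M. X (Suc (Suc m)) \<omega> = g (X (Suc m) \<omega>) (Y (Suc m) \<omega>)"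
  by (rule model_facts) simp

lemma X_in_S: "\<omega> \<in> space M \<Longrightarrow> X (Suc m) \<omega> \<in> S"
  by (rule model_facts) simp_all

lemma Y_measurable [measurable]: "Y (Suc m) \<in> borel_measurable M"
  by (rule model_facts) simp

lemma X_measurable_algebra:
  assumes "\<eta> t \<in> borel_measurable G" "space G = space M" "1 \<le> t"
  shows "X t \<in> borel_measurable G"
proof -
  have "B \<in> borel_measurable (restrict_space borel \<Theta>)"
    by (rule borel_measurable_mono_on_fnc) (rule strict_mono_on_imp_mono_on[OF strict_mono_on_derivative])
  moreover have "\<eta> t \<in> G \<rightarrow>\<^sub>M restrict_space borel \<Theta>"
    using assms model_facts(3) by (intro measurable_restrict_space2) auto
  ultimately show ?thesis by (rule measurable_compose[rotated])
qed

lemma X_measurable [measurable]: "X (Suc m) \<in> borel_measurable M"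
  by (rule X_measurable_algebra) (simp_all add: model_facts(1))

lemma past_subalgebra: "subalgebra M (past m)"
  by (rule subalgebra_observation_algebra) (simp_all add: model_facts(1,2))

lemma past_sets: "D \<in> sets (past m) \<Longrightarrow> D \<in> sets M"
  using past_subalgebra by (auto simp: subalgebra_def)

text \<open>
  Integrating the conditional probability of \<open>Y \<in> C\<close> over an event of the past gives a joint
  probability; the conditional law is then realised by a uniform variable through \<open>q\<close>.
\<close>

lemma conditional_law_rectangle:
  assumes D: "D \<in> sets (past m)" and C: "C \<in> sets borel"
  shows "emeasure M (D \<inter> (Y (Suc m) -` C \<inter> space M)) =
    (\<integral>\<^sup>+\<omega>. indicator D \<omega> * emeasure uniform01 {u. q (X (Suc m) \<omega>) u \<in> C} \<partial>M)"
proof -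
  interpret finite_measure_subalgebra M "past m"
    using past_subalgebra by unfold_locales
  let ?Y = "Y (Suc m) -` C \<inter> space M"
  define p where "p = (\<lambda>\<omega>. measure uniform01 {u. q (X (Suc m) \<omega>) u \<in> C})"
  have YC [measurable]: "?Y \<in> sets M" using Y_measurable C by (rule measurable_sets)
  have [measurable]: "D \<in> sets M" using D by (rule past_sets)
  have [measurable]: "p \<in> borel_measurable M"
  proof -
    have "(\<lambda>(\<omega>, u). q (X (Suc m) \<omega>) u) \<in> borel_measurable (M \<Otimes>\<^sub>M uniform01)" by measurable
    from measurable_sets[OF this C]
    have "(\<lambda>\<omega>. emeasure uniform01 (Pair \<omega> -` ((\<lambda>(\<omega>, u). q (X (Suc m) \<omega>) u) -` C \<inter> space (M \<Otimes>\<^sub>M uniform01)))) \<in> borel_measurable M"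
      by (rule chain.measurable_emeasure_Pair)
    from borel_measurable_enn2real[OF this] show ?thesis
      by (rule measurable_cong[THEN iffD1, rotated])
        (auto simp: p_def measure_def[of uniform01] space_pair_measure
          intro!: arg_cong[where f="\<lambda>A. enn2real (emeasure uniform01 A)"])
  qed
  have p_bounds: "0 \<le> p \<omega>" "p \<omega> \<le> 1" for \<omega> by (simp_all add: p_def)
  have p_law: "measure (law (\<eta> (Suc m) \<omega>)) C = p \<omega>" if \<omega>: "\<omega> \<in> space M" for \<omega>
  proof -
    have x: "X (Suc m) \<omega> \<in> S" and par: "\<eta> (Suc m) \<omega> \<in> \<Theta>" using model_facts(3,4)[of "Suc m"] \<omega> by auto
    have qm: "q (X (Suc m) \<omega>) \<in> uniform01 \<rightarrow>\<^sub>M borel" by measurable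
    have "measure (law (\<eta> (Suc m) \<omega>)) C = measure (distr uniform01 borel (q (X (Suc m) \<omega>))) C"
      unfolding distr_q[OF x] mean_law_at_derivative[OF par] ..
    also have "\<dots> = p \<omega>"
      unfolding p_def by (subst measure_distr[OF qm C]) (simp add: vimage_def)
    finally show ?thesis .
  qed
  have "measure M (D \<inter> ?Y) = (\<integral>\<omega>\<in>D. indicator ?Y \<omega> \<partial>M)"
    unfolding set_lebesgue_integral_def by (simp add: indicator_inter_arith[symmetric])
  also have "\<dots> = (\<integral>\<omega>\<in>D. real_cond_exp M (past m) (indicator ?Y) \<omega> \<partial>M)"
    by (rule real_cond_exp_intA[OF integrable_real_indicator[OF YC] D]) (simp add: M.emeasure_eq_measure)
  also have "\<dots> = (\<integral>\<omega>. indicator D \<omega> * p \<omega> \<partial>M)"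
    unfolding set_lebesgue_integral_def
  proof (rule integral_cong_AE)
    show "AE \<omega> in M. indicator D \<omega> *\<^sub>R real_cond_exp M (past m) (indicator ?Y) \<omega> = indicator D \<omega> * p \<omega>"
    proof -
      have "AE \<omega> in M. real_cond_exp M (past m) (indicator ?Y) \<omega> = measure (law (\<eta> (Suc m) \<omega>)) C"
        using model_facts(5)[of "Suc m" C] C by simp
      then show ?thesis using AE_space by eventually_elim (simp add: p_law)
    qed
  qed simp_all
  finally have meas: "measure M (D \<inter> ?Y) = (\<integral>\<omega>. indicator D \<omega> * p \<omega> \<partial>M)" .
  have "emeasure M (D \<inter> ?Y) = ennreal (\<integral>\<omega>. indicator D \<omega> * p \<omega> \<partial>M)"
    by (simp add: M.emeasure_eq_measure meas)
  also have "\<dots> = (\<integral>\<^sup>+\<omega>. ennreal (indicator D \<omega> * p \<omega>) \<partial>M)"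
    by (rule nn_integral_eq_integral[symmetric])
      (auto intro!: M.integrable_const_bound[where B=1] simp: p_bounds split: split_indicator)
  also have "\<dots> = (\<integral>\<^sup>+\<omega>. indicator D \<omega> * emeasure uniform01 {u. q (X (Suc m) \<omega>) u \<in> C} \<partial>M)"
    by (intro nn_integral_cong) (auto simp: p_def chain.emeasure_eq_measure split: split_indicator)
  finally show ?thesis .
qed

text \<open>
  Jointly with the past, an observation is distributed as \<open>q X u\<close> with \<open>u\<close> uniform and independent.
  Rectangles determine a law on the product.
\<close>

lemma conditional_law:
  "distr M (past m \<Otimes>\<^sub>M borel) (\<lambda>\<omega>. (\<omega>, Y (Suc m) \<omega>)) =
   distr (M \<Otimes>\<^sub>M uniform01) (past m \<Otimes>\<^sub>M borel) (\<lambda>(\<omega>, u). (\<omega>, q (X (Suc m) \<omega>) u))"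
  (is "?L = ?R")
proof -
  let ?P = "past m \<Otimes>\<^sub>M (borel :: real measure)"
  let ?E = "{D \<times> C |D C. D \<in> sets (past m) \<and> C \<in> sets (borel :: real measure)}"
  have id: "(\<lambda>\<omega>. \<omega>) \<in> M \<rightarrow>\<^sub>M past m"
    by (rule measurableI) (auto simp: past_sets)
  have L: "(\<lambda>\<omega>. (\<omega>, Y (Suc m) \<omega>)) \<in> M \<rightarrow>\<^sub>M ?P"
    by (intro measurable_Pair id Y_measurable)
  have R: "(\<lambda>(\<omega>, u). (\<omega>, q (X (Suc m) \<omega>) u)) \<in> M \<Otimes>\<^sub>M uniform01 \<rightarrow>\<^sub>M ?P"
    unfolding case_prod_unfold
    by (intro measurable_Pair measurable_compose[OF measurable_fst id]) measurable
  show ?thesis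
  proof (rule measure_eqI_generator_eq[OF Int_stable_pair_measure_generator[of "past m" borel],
        where A="\<lambda>_. space M \<times> UNIV" and \<Omega>="space ?P"])
    show "?E \<subseteq> Pow (space ?P)"
      using sets.space_closed[of "past m"] by (auto simp: space_pair_measure)
    show "sets ?L = sigma_sets (space ?P) ?E" "sets ?R = sigma_sets (space ?P) ?E"
      by (simp_all add: sets_pair_measure space_pair_measure)
    show "range (\<lambda>_. space M \<times> UNIV) \<subseteq> ?E"
    proof -
      have "space M \<in> sets (past m)" using sets.top[of "past m"] by simp
      moreover have "UNIV \<in> sets (borel :: real measure)" by simp
      ultimately show ?thesis by blast
    qed
    show "(\<Union>i::nat. space M \<times> UNIV) = space ?P" by (simp add: space_pair_measure)
    interpret L: prob_space ?L by (rule M.prob_space_distr[OF L])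
    show "emeasure ?L (space M \<times> UNIV) \<noteq> \<infinity>" for i :: nat by simp
  next
    fix Z assume "Z \<in> ?E"
    then obtain D C where Z: "Z = D \<times> C" and D: "D \<in> sets (past m)" and C: "C \<in> sets (borel :: real measure)" by auto
    have DC: "D \<times> C \<in> sets ?P" using D C by auto
    have Dsub: "D \<subseteq> space M" using sets.sets_into_space[OF D] by simp
    have "emeasure ?L Z = emeasure M (D \<inter> (Y (Suc m) -` C \<inter> space M))"
      unfolding Z emeasure_distr[OF L DC] using Dsub by (intro arg_cong[where f="emeasure M"]) auto
    also have "\<dots> = (\<integral>\<^sup>+\<omega>. indicator D \<omega> * emeasure uniform01 {u. q (X (Suc m) \<omega>) u \<in> C} \<partial>M)"
      by (rule conditional_law_rectangle[OF D C])
    also have "\<dots> = (\<integral>\<^sup>+\<omega>. emeasure uniform01 (Pair \<omega> -` ((\<lambda>(\<omega>, u). (\<omega>, q (X (Suc m) \<omega>) u)) -` (D \<times> C) \<inter> space (M \<Otimes>\<^sub>M uniform01))) \<partial>M)"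
      by (intro nn_integral_cong)
        (auto simp: space_pair_measure vimage_def split: split_indicator intro!: arg_cong[where f="emeasure uniform01"])
    also have "\<dots> = emeasure ?R Z"
      unfolding Z emeasure_distr[OF R DC]
      by (rule chain.emeasure_pair_measure_alt[symmetric]) (rule measurable_sets[OF R DC])
    finally show "emeasure ?L Z = emeasure ?R Z" .
  qed
qed

lemma nn_integral_observation:
  assumes f [measurable]: "f \<in> borel_measurable (past m \<Otimes>\<^sub>M borel)"
  shows "(\<integral>\<^sup>+\<omega>. f (\<omega>, Y (Suc m) \<omega>) \<partial>M) = (\<integral>\<^sup>+\<omega>. \<integral>\<^sup>+u. f (\<omega>, q (X (Suc m) \<omega>) u) \<partial>uniform01 \<partial>M)"
proof -
  have id [measurable]: "(\<lambda>\<omega>. \<omega>) \<in> M \<rightarrow>\<^sub>M past m"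
    by (rule measurableI) (auto simp: past_sets)
  have L: "(\<lambda>\<omega>. (\<omega>, Y (Suc m) \<omega>)) \<in> M \<rightarrow>\<^sub>M past m \<Otimes>\<^sub>M borel"
    by (intro measurable_Pair id Y_measurable)
  have R: "(\<lambda>(\<omega>, u). (\<omega>, q (X (Suc m) \<omega>) u)) \<in> M \<Otimes>\<^sub>M uniform01 \<rightarrow>\<^sub>M past m \<Otimes>\<^sub>M borel"
    unfolding case_prod_unfold
    by (intro measurable_Pair measurable_compose[OF measurable_fst id]) measurable
  have "(\<integral>\<^sup>+\<omega>. f (\<omega>, Y (Suc m) \<omega>) \<partial>M) = integral\<^sup>N (distr M (past m \<Otimes>\<^sub>M borel) (\<lambda>\<omega>. (\<omega>, Y (Suc m) \<omega>))) f"
    by (rule nn_integral_distr[OF L, symmetric]) (simp add: f)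
  also have "\<dots> = (\<integral>\<^sup>+z. f ((\<lambda>(\<omega>, u). (\<omega>, q (X (Suc m) \<omega>) u)) z) \<partial>(M \<Otimes>\<^sub>M uniform01))"
    unfolding conditional_law by (rule nn_integral_distr[OF R]) (simp add: f)
  also have "\<dots> = (\<integral>\<^sup>+\<omega>. \<integral>\<^sup>+u. f (\<omega>, q (X (Suc m) \<omega>) u) \<partial>uniform01 \<partial>M)"
    using chain.nn_integral_fst[of "\<lambda>z. f ((\<lambda>(\<omega>, u). (\<omega>, q (X (Suc m) \<omega>) u)) z)" M] measurable_compose[OF R f] by simp
  finally show ?thesis .
qed

lemma AE_observation_in_E: "AE \<omega> in M. Y (Suc m) \<omega> \<in> E"
proof -
  have "(\<integral>\<^sup>+\<omega>. indicator (- E) (Y (Suc m) \<omega>) \<partial>M) = (\<integral>\<^sup>+\<omega>. \<integral>\<^sup>+u. indicator (- E) (q (X (Suc m) \<omega>) u) \<partial>uniform01 \<partial>M)"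
    using nn_integral_observation[of "\<lambda>z. indicator (- E) (snd z)" m] by simp
  also have "\<dots> = 0" by (simp add: q_in_E)
  finally have "AE \<omega> in M. indicator (- E) (Y (Suc m) \<omega>) = (0::ennreal)"
    by (subst (asm) nn_integral_0_iff_AE) simp_all
  then show ?thesis by eventually_elim (simp add: indicator_eq_0_iff)
qed

text \<open>
  The recursion for the mean process holds only almost surely, so \<open>X\<close> itself need not be measurable
  with respect to the past. Following the recursion from the initial parameter gives a version that is.
\<close>

lemma mean_process_past_measurable:
  obtains V where "V \<in> borel_measurable (past m)" "AE \<omega> in M. X (Suc m) \<omega> = V \<omega>"
proof -
  have "\<exists>V\<in>borel_measurable (past m). AE \<omega> in M. X (Suc m) \<omega> = V \<omega>"
  proof (induction m)
    case 0
    have "X (Suc 0) \<in> borel_measurable (past 0)"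
      using measurable_initial_parameter[of \<eta> M Y 0] by (intro X_measurable_algebra) simp_all
    then show ?case by (intro bexI[of _ "X (Suc 0)"]) simp_all
  next
    case (Suc m)
    then obtain V where V: "V \<in> borel_measurable (past m)" "AE \<omega> in M. X (Suc m) \<omega> = V \<omega>" by auto
    have "V \<in> borel_measurable (past (Suc m))"
      using V(1) observation_algebra_mono[of m "Suc m" M \<eta> Y]
      by (auto simp: measurable_def)
    moreover have "Y (Suc m) \<in> borel_measurable (past (Suc m))" by (rule measurable_observation) simp_all
    ultimately have "(\<lambda>\<omega>. g_ext (V \<omega>) (Y (Suc m) \<omega>)) \<in> borel_measurable (past (Suc m))" by measurable
    then show ?case
    proof (rule bexI[rotated])
      show "AE \<omega> in M. X (Suc (Suc m)) \<omega> = g_ext (V \<omega>) (Y (Suc m) \<omega>)"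
        using V(2) X_recursion[of m] AE_observation_in_E[of m] AE_space
      proof eventually_elim
        case (elim \<omega>)
        then show ?case using X_in_S[of \<omega> m] g_ext_eq[of "X (Suc m) \<omega>" "Y (Suc m) \<omega>"] by simp
      qed
    qed
  qed
  then show ?thesis using that by blast
qed

text \<open>
  Integration of a function of the observation and of the past, where the next mean is expressed as
  \<open>g_ext V y\<close> by a version \<open>V\<close> of the current mean that is measurable with respect to the past.
\<close>

lemma nn_integral_transition:
  assumes D: "D \<in> sets (past m)" and f [measurable]: "f \<in> borel_measurable (borel \<Otimes>\<^sub>M borel)"
  shows "(\<integral>\<^sup>+\<omega>. indicator D \<omega> * f (Y (Suc m) \<omega>, X (Suc (Suc m)) \<omega>) \<partial>M) =
    (\<integral>\<^sup>+\<omega>. indicator D \<omega> * (\<integral>\<^sup>+u. f (q (X (Suc m) \<omega>) u, F u (X (Suc m) \<omega>)) \<partial>uniform01) \<partial>M)"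
proof -
  obtain V where V [measurable]: "V \<in> borel_measurable (past m)" and XV: "AE \<omega> in M. X (Suc m) \<omega> = V \<omega>"
    by (rule mean_process_past_measurable)
  note [measurable] = D
  let ?f = "\<lambda>(\<omega>, y). indicator D \<omega> * f (y, g_ext (V \<omega>) y)"
  have "(\<integral>\<^sup>+\<omega>. indicator D \<omega> * f (Y (Suc m) \<omega>, X (Suc (Suc m)) \<omega>) \<partial>M) = (\<integral>\<^sup>+\<omega>. ?f (\<omega>, Y (Suc m) \<omega>) \<partial>M)"
  proof (rule nn_integral_cong_AE)
    show "AE \<omega> in M. indicator D \<omega> * f (Y (Suc m) \<omega>, X (Suc (Suc m)) \<omega>) = ?f (\<omega>, Y (Suc m) \<omega>)"
      using XV X_recursion[of m] AE_observation_in_E[of m] AE_space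
    proof eventually_elim
      case (elim \<omega>)
      then show ?case using X_in_S[of \<omega> m] g_ext_eq[of "X (Suc m) \<omega>" "Y (Suc m) \<omega>"] by simp
    qed
  qed
  also have "\<dots> = (\<integral>\<^sup>+\<omega>. \<integral>\<^sup>+u. ?f (\<omega>, q (X (Suc m) \<omega>) u) \<partial>uniform01 \<partial>M)"
    by (rule nn_integral_observation) measurable
  also have "\<dots> = (\<integral>\<^sup>+\<omega>. indicator D \<omega> * (\<integral>\<^sup>+u. f (q (X (Suc m) \<omega>) u, F u (X (Suc m) \<omega>)) \<partial>uniform01) \<partial>M)"
  proof (rule nn_integral_cong_AE)
    show "AE \<omega> in M. (\<integral>\<^sup>+u. ?f (\<omega>, q (X (Suc m) \<omega>) u) \<partial>uniform01) =
        indicator D \<omega> * (\<integral>\<^sup>+u. f (q (X (Suc m) \<omega>) u, F u (X (Suc m) \<omega>)) \<partial>uniform01)"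
      using XV AE_space
    proof eventually_elim
      case (elim \<omega>)
      let ?x = "X (Suc m) \<omega>"
      have x: "?x \<in> S" using X_in_S[of \<omega> m] elim(2) by simp
      have "(\<integral>\<^sup>+u. ?f (\<omega>, q ?x u) \<partial>uniform01) = (\<integral>\<^sup>+u. indicator D \<omega> * f (q ?x u, F u ?x) \<partial>uniform01)"
        using F_eq_g_ext[OF x] by (intro nn_integral_cong_AE, eventually_elim) (simp add: elim(1)[symmetric])
      also have "\<dots> = indicator D \<omega> * (\<integral>\<^sup>+u. f (q ?x u, F u ?x) \<partial>uniform01)"
        by (rule nn_integral_cmult) measurable
      finally show ?case .
    qed
  qed
  finally show ?thesis .
qed

lemma distr_mean_process:
  assumes \<pi>: "chain.stationary \<pi>" and start: "distr M borel (X 1) = \<pi>"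
  shows "distr M borel (X (Suc m)) = \<pi>"
proof (induction m)
  case 0
  then show ?case using start by simp
next
  case (Suc m)
  have \<pi>': "prob_space \<pi>" "sets \<pi> = sets borel"
    and inv: "distr (\<pi> \<Otimes>\<^sub>M uniform01) borel (\<lambda>(x, u). F u x) = \<pi>"
    using \<pi> by (simp_all add: chain.stationary_def)
  show ?case
  proof (rule measure_eqI)
    fix C assume "C \<in> sets (distr M borel (X (Suc (Suc m))))"
    then have C [measurable]: "C \<in> sets borel" by simp
    let ?k = "\<lambda>x. \<integral>\<^sup>+u. indicator C (F u x) \<partial>uniform01"
    have k_eq: "?k x = emeasure uniform01 {u. F u x \<in> C}" for x
    proof -
      have "(\<lambda>u. F u x) \<in> borel_measurable uniform01" by measurable
      from measurable_sets[OF this C] have "{u. F u x \<in> C} \<in> sets uniform01" by (simp add: vimage_def)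
      from nn_integral_indicator[OF this] show ?thesis by (simp only: indicator_def mem_Collect_eq)
    qed
    have "emeasure (distr M borel (X (Suc (Suc m)))) C = (\<integral>\<^sup>+x. indicator C x \<partial>distr M borel (X (Suc (Suc m))))"
      by simp
    also have "\<dots> = (\<integral>\<^sup>+\<omega>. indicator C (X (Suc (Suc m)) \<omega>) \<partial>M)"
      by (rule nn_integral_distr) measurable
    also have "\<dots> = (\<integral>\<^sup>+\<omega>. indicator (space M) \<omega> * (\<lambda>(y, x). indicator C x) (Y (Suc m) \<omega>, X (Suc (Suc m)) \<omega>) \<partial>M)"
      by (intro nn_integral_cong) simp
    also have "\<dots> = (\<integral>\<^sup>+\<omega>. indicator (space M) \<omega> * ?k (X (Suc m) \<omega>) \<partial>M)"
      using nn_integral_transition[of "space M" m "\<lambda>(y, x). indicator C x"] sets.top[of "past m"] by simp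
    also have "\<dots> = (\<integral>\<^sup>+\<omega>. ?k (X (Suc m) \<omega>) \<partial>M)"
      by (intro nn_integral_cong) simp
    also have "\<dots> = (\<integral>\<^sup>+x. ?k x \<partial>distr M borel (X (Suc m)))"
      by (rule nn_integral_distr[symmetric]) measurable
    also have "\<dots> = (\<integral>\<^sup>+x. emeasure uniform01 {u. F u x \<in> C} \<partial>\<pi>)"
      unfolding Suc k_eq ..
    also have "\<dots> = emeasure \<pi> C"
      unfolding emeasure_transition_step[OF \<pi>' C, symmetric] inv ..
    finally show "emeasure (distr M borel (X (Suc (Suc m)))) C = emeasure \<pi> C" .
  qed (simp add: \<pi>')
qed

end

context observation_model
begin

text \<open>
  The probability that the chain started at \<open>x\<close> produces its first \<open>n\<close> observations in
  \<open>C 0, \<dots>, C (n - 1)\<close>.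
\<close>

primrec path_prob :: "nat \<Rightarrow> (nat \<Rightarrow> real set) \<Rightarrow> real \<Rightarrow> ennreal" where
  "path_prob 0 C x = 1"
| "path_prob (Suc n) C x =
    (\<integral>\<^sup>+u. indicator (C 0) (q x u) * path_prob n (\<lambda>i. C (Suc i)) (F u x) \<partial>uniform01)"

lemma path_prob_measurable:
  "(\<And>i. C i \<in> sets borel) \<Longrightarrow> path_prob n C \<in> borel_measurable borel"
proof (induction n arbitrary: C)
  case (Suc n)
  have [measurable]: "path_prob n (\<lambda>i. C (Suc i)) \<in> borel_measurable borel" "C 0 \<in> sets borel"
    using Suc by auto
  have "(\<lambda>x. \<integral>\<^sup>+u. indicator (C 0) (q x u) * path_prob n (\<lambda>i. C (Suc i)) (F u x) \<partial>uniform01) \<in> borel_measurable borel"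
    by measurable
  moreover have "path_prob (Suc n) C = (\<lambda>x. \<integral>\<^sup>+u. indicator (C 0) (q x u) * path_prob n (\<lambda>i. C (Suc i)) (F u x) \<partial>uniform01)"
    by (simp add: fun_eq_iff)
  ultimately show ?case by simp
next
  case 0
  have "path_prob 0 C = (\<lambda>_. 1)" by (simp add: fun_eq_iff)
  then show ?case by simp
qed

end

context observation_process
begin

text \<open>
  The event that the current observation lies in \<open>C 0\<close> is absorbed into the event \<open>D\<close> of the past; the
  induction hypothesis at the next time and one transition then give the claim. This is why \<open>D\<close> and
  the time are arbitrary.
\<close>

lemma emeasure_path:
  assumes "D \<in> sets (past m)" "\<And>i. C i \<in> sets borel"
  shows "emeasure M (D \<inter> {\<omega> \<in> space M. \<forall>i<n. Y (Suc (m + i)) \<omega> \<in> C i}) =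
    (\<integral>\<^sup>+\<omega>. indicator D \<omega> * path_prob n C (X (Suc m) \<omega>) \<partial>M)"
  using assms
proof (induction n arbitrary: m D C)
  case 0
  have D: "D \<in> sets M" using 0(1) by (rule past_sets)
  then have "D \<inter> {\<omega> \<in> space M. \<forall>i<0. Y (Suc (m + i)) \<omega> \<in> C i} = D" using sets.sets_into_space[OF D] by auto
  then show ?case using D by simp
next
  case (Suc n)
  have [measurable]: "path_prob n (\<lambda>i. C (Suc i)) \<in> borel_measurable borel" "C 0 \<in> sets borel"
    using Suc.prems by (auto intro: path_prob_measurable)
  let ?D = "D \<inter> (Y (Suc m) -` C 0 \<inter> space M)"
  have "Y (Suc m) -` C 0 \<inter> space (past (Suc m)) \<in> sets (past (Suc m))"
    by (rule measurable_sets[OF measurable_observation]) simp_all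
  then have "Y (Suc m) -` C 0 \<inter> space M \<in> sets (past (Suc m))" by simp
  moreover have "D \<in> sets (past (Suc m))"
    using Suc.prems(1) observation_algebra_mono[of m "Suc m" M \<eta> Y] by auto
  ultimately have D': "?D \<in> sets (past (Suc m))" by (rule sets.Int[rotated])
  have "D \<inter> {\<omega> \<in> space M. \<forall>i<Suc n. Y (Suc (m + i)) \<omega> \<in> C i} =
      ?D \<inter> {\<omega> \<in> space M. \<forall>i<n. Y (Suc (Suc m + i)) \<omega> \<in> C (Suc i)}"
    by (auto simp: All_less_Suc2)
  then have "emeasure M (D \<inter> {\<omega> \<in> space M. \<forall>i<Suc n. Y (Suc (m + i)) \<omega> \<in> C i}) =
      (\<integral>\<^sup>+\<omega>. indicator ?D \<omega> * path_prob n (\<lambda>i. C (Suc i)) (X (Suc (Suc m)) \<omega>) \<partial>M)"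
    using Suc.IH[OF D', of "\<lambda>i. C (Suc i)"] Suc.prems(2) by simp
  also have "\<dots> = (\<integral>\<^sup>+\<omega>. indicator D \<omega> * (\<lambda>(y, x). indicator (C 0) y * path_prob n (\<lambda>i. C (Suc i)) x) (Y (Suc m) \<omega>, X (Suc (Suc m)) \<omega>) \<partial>M)"
    by (intro nn_integral_cong) (auto split: split_indicator)
  also have "\<dots> = (\<integral>\<^sup>+\<omega>. indicator D \<omega> * path_prob (Suc n) C (X (Suc m) \<omega>) \<partial>M)"
    by (subst nn_integral_transition[OF Suc.prems(1)]) simp_all
  finally show ?case .
qed

text \<open>
  For a box the probability is the integral of \<open>path_prob\<close> against the law of the mean at the starting
  time, which is \<open>\<pi>\<close> at all times. Times not in \<open>J\<close> are filled in with the trivial condition.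
\<close>

theorem stationary_observations:
  assumes \<pi>: "chain.stationary \<pi>" and start: "distr M borel (X 1) = \<pi>"
  shows "stationary_series M Y"
  unfolding stationary_series_def
proof (intro allI impI, elim conjE)
  fix J :: "nat set" and k :: nat assume J: "finite J" "J \<subseteq> {1..}"
  obtain n where n: "J \<subseteq> {1..n}"
    using J by (metis Max_ge atLeastAtMost_iff atLeast_iff subset_iff)
  have Y1: "Y i \<in> borel_measurable M" if "1 \<le> i" for i using that by (rule model_facts)
  have meas: "(\<lambda>\<omega>. \<lambda>i\<in>J. Y (i + l) \<omega>) \<in> M \<rightarrow>\<^sub>M (\<Pi>\<^sub>M i\<in>J. borel)" for l
    using J by (intro measurable_restrict Y1) auto
  have box: "emeasure (distr M (\<Pi>\<^sub>M i\<in>J. borel) (\<lambda>\<omega>. \<lambda>i\<in>J. Y (i + l) \<omega>)) (Pi\<^sub>E J C) =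
      (\<integral>\<^sup>+x. path_prob n (\<lambda>i. if Suc i \<in> J then C (Suc i) else UNIV) x \<partial>\<pi>)"
    if C: "\<And>i. i \<in> J \<Longrightarrow> C i \<in> sets borel" for C :: "nat \<Rightarrow> real set" and l
  proof -
    \<comment> \<open>Position \<open>i\<close> in a path corresponds to the time index \<open>Suc i\<close>.\<close>
    let ?C = "\<lambda>i. if Suc i \<in> J then C (Suc i) else UNIV"
    have C': "?C i \<in> sets borel" for i using C by simp
    note [measurable] = path_prob_measurable[OF C', of n]
    have "Pi\<^sub>E J C \<in> sets (\<Pi>\<^sub>M i\<in>J. borel)" using C by (intro sets_PiM_I_finite J(1)) auto
    then have "emeasure (distr M (\<Pi>\<^sub>M i\<in>J. borel) (\<lambda>\<omega>. \<lambda>i\<in>J. Y (i + l) \<omega>)) (Pi\<^sub>E J C) =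
        emeasure M ((\<lambda>\<omega>. \<lambda>i\<in>J. Y (i + l) \<omega>) -` Pi\<^sub>E J C \<inter> space M)"
      by (rule emeasure_distr[OF meas])
    also have "(\<lambda>\<omega>. \<lambda>i\<in>J. Y (i + l) \<omega>) -` Pi\<^sub>E J C \<inter> space M =
        space M \<inter> {\<omega> \<in> space M. \<forall>i<n. Y (Suc (l + i)) \<omega> \<in> ?C i}"
    proof -
      have "(\<forall>i\<in>J. Y (i + l) \<omega> \<in> C i) \<longleftrightarrow> (\<forall>i<n. Y (Suc (l + i)) \<omega> \<in> ?C i)" for \<omega>
      proof
        assume *: "\<forall>i<n. Y (Suc (l + i)) \<omega> \<in> ?C i"
        show "\<forall>i\<in>J. Y (i + l) \<omega> \<in> C i"
        proof
          fix i assume i: "i \<in> J"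
          then obtain j where j: "i = Suc j" "j < n"
            using n by (cases i) (auto simp: subset_eq)
          then show "Y (i + l) \<omega> \<in> C i" using *[rule_format, of j] i by (simp add: add.commute)
        qed
      next
        assume *: "\<forall>i\<in>J. Y (i + l) \<omega> \<in> C i"
        show "\<forall>i<n. Y (Suc (l + i)) \<omega> \<in> ?C i"
        proof (intro allI impI)
          fix i
          show "Y (Suc (l + i)) \<omega> \<in> ?C i"
            using bspec[OF *, of "Suc i"] by (cases "Suc i \<in> J") (simp_all add: add.commute[of i l])
        qed
      qed
      moreover have "(\<lambda>i\<in>J. Y (i + l) \<omega>) \<in> Pi\<^sub>E J C \<longleftrightarrow> (\<forall>i\<in>J. Y (i + l) \<omega> \<in> C i)" for \<omega>
        by (simp add: PiE_iff)
      ultimately have "(\<lambda>i\<in>J. Y (i + l) \<omega>) \<in> Pi\<^sub>E J C \<longleftrightarrow> (\<forall>i<n. Y (Suc (l + i)) \<omega> \<in> ?C i)" for \<omega>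
        by (simp only:)
      then show ?thesis by blast
    qed
    also have "emeasure M \<dots> = (\<integral>\<^sup>+\<omega>. indicator (space M) \<omega> * path_prob n ?C (X (Suc l) \<omega>) \<partial>M)"
      by (rule emeasure_path) (use sets.top[of "past l"] C' in simp_all)
    also have "\<dots> = (\<integral>\<^sup>+\<omega>. path_prob n ?C (X (Suc l) \<omega>) \<partial>M)"
      by (intro nn_integral_cong) simp
    also have "\<dots> = (\<integral>\<^sup>+x. path_prob n ?C x \<partial>distr M borel (X (Suc l)))"
      by (rule nn_integral_distr[symmetric]) measurable
    also have "\<dots> = (\<integral>\<^sup>+x. path_prob n ?C x \<partial>\<pi>)"
      unfolding distr_mean_process[OF \<pi> start] ..
    finally show ?thesis .
  qed
  show "distr M (\<Pi>\<^sub>M i\<in>J. borel) (\<lambda>\<omega>. \<lambda>i\<in>J. Y (i + k) \<omega>) = distr M (\<Pi>\<^sub>M i\<in>J. borel) (\<lambda>\<omega>. \<lambda>i\<in>J. Y i \<omega>)"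
  proof (rule measure_eqI_PiM_finite[OF J(1), where A="\<lambda>_. Pi\<^sub>E J (\<lambda>_. UNIV)"])
    fix C :: "nat \<Rightarrow> real set" assume "\<And>i. i \<in> J \<Longrightarrow> C i \<in> sets borel"
    then show "emeasure (distr M (\<Pi>\<^sub>M i\<in>J. borel) (\<lambda>\<omega>. \<lambda>i\<in>J. Y (i + k) \<omega>)) (Pi\<^sub>E J C) =
        emeasure (distr M (\<Pi>\<^sub>M i\<in>J. borel) (\<lambda>\<omega>. \<lambda>i\<in>J. Y i \<omega>)) (Pi\<^sub>E J C)"
      using box[of C k] box[of C 0] by simp
  next
    show "range (\<lambda>_::nat. Pi\<^sub>E J (\<lambda>_. UNIV :: real set)) \<subseteq> prod_algebra J (\<lambda>_. borel)"
      using prod_algebraI_finite[OF J(1), of "\<lambda>_. UNIV" "\<lambda>_. borel :: real measure"] by auto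
    interpret L: prob_space "distr M (\<Pi>\<^sub>M i\<in>J. borel) (\<lambda>\<omega>. \<lambda>i\<in>J. Y (i + k) \<omega>)"
      by (rule M.prob_space_distr[OF meas])
    show "emeasure (distr M (\<Pi>\<^sub>M i\<in>J. borel) (\<lambda>\<omega>. \<lambda>i\<in>J. Y (i + k) \<omega>)) (Pi\<^sub>E J (\<lambda>_. UNIV)) \<noteq> \<infinity>" for i :: nat
      by simp
  qed (simp_all add: space_PiM)
qed

end

section \<open>Independent sequences and product measures\<close>

text \<open>
  For \<open>n = 0\<close> both sides are the only probability measure on a one-point space; for
  \<open>n > 0\<close> the claim is the characterisation of independence by product laws.
\<close>

lemma distr_iid_initial_segment:
  assumes N: "prob_space N" and T: "prob_space T" "sets T = sets borel"
    and law: "\<And>t. 1 \<le> t \<Longrightarrow> distr N borel (U t) = T"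
    and indep: "prob_space.indep_vars N (\<lambda>_. borel) U {1..}"
  shows "distr N (\<Pi>\<^sub>M t\<in>{1..n::nat}. T) (\<lambda>\<omega>. \<lambda>t\<in>{1..n}. U t \<omega>) = (\<Pi>\<^sub>M t\<in>{1..n}. T)"
proof -
  interpret N: prob_space N by fact
  interpret T: prob_space T by fact
  have sets_eq: "sets (\<Pi>\<^sub>M t\<in>{1..n}. T) = sets (\<Pi>\<^sub>M t\<in>{1..n}. borel)"
    by (intro sets_PiM_cong) (simp_all add: T(2))
  show ?thesis
  proof (cases "n = 0")
    case True
    interpret product_prob_space "\<lambda>_::nat. T" "{1..n}" by unfold_locales
    have "(\<lambda>\<omega>. \<lambda>t\<in>{1..n}. U t \<omega>) \<in> N \<rightarrow>\<^sub>M (\<Pi>\<^sub>M t\<in>{1..n}. T)" using True by (intro measurable_restrict) auto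
    then interpret L: prob_space "distr N (\<Pi>\<^sub>M t\<in>{1..n}. T) (\<lambda>\<omega>. \<lambda>t\<in>{1..n}. U t \<omega>)"
      by (rule N.prob_space_distr)
    show ?thesis
    proof (rule measure_eqI)
      fix D assume "D \<in> sets (distr N (\<Pi>\<^sub>M t\<in>{1..n}. T) (\<lambda>\<omega>. \<lambda>t\<in>{1..n}. U t \<omega>))"
      then have "D \<subseteq> {\<lambda>_. undefined}"
        using True sets.sets_into_space[of D "\<Pi>\<^sub>M t\<in>{1..n}. T"] by (auto simp: space_PiM)
      then have "D = {} \<or> D = space (\<Pi>\<^sub>M t\<in>{1..n}. T)" using True by (auto simp: space_PiM)
      then show "emeasure (distr N (\<Pi>\<^sub>M t\<in>{1..n}. T) (\<lambda>\<omega>. \<lambda>t\<in>{1..n}. U t \<omega>)) D = emeasure (\<Pi>\<^sub>M t\<in>{1..n}. T) D"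
        using L.emeasure_space_1 P.emeasure_space_1 by auto
    qed simp
  next
    case False
    have "N.indep_vars (\<lambda>_. borel) U {1..n}"
      using indep by (rule N.indep_vars_subset) auto
    then have "distr N (\<Pi>\<^sub>M t\<in>{1..n}. borel) (\<lambda>\<omega>. \<lambda>t\<in>{1..n}. U t \<omega>) = (\<Pi>\<^sub>M t\<in>{1..n}. distr N borel (U t))"
      using False N.indep_vars_iff_distr_eq_PiM'[where I="{1..n}" and M'="\<lambda>_. borel" and X=U] by (auto simp: N.indep_vars_def)
    also have "\<dots> = (\<Pi>\<^sub>M t\<in>{1..n}. T)" by (intro PiM_cong) (auto simp: law)
    finally show ?thesis
      using distr_cong[OF refl sets_eq, of N "\<lambda>\<omega>. \<lambda>t\<in>{1..n}. U t \<omega>" "\<lambda>\<omega>. \<lambda>t\<in>{1..n}. U t \<omega>"] by simp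
  qed
qed

lemma AE_pair_fst:
  assumes "prob_space M2" and "AE x in M1. P x"
  shows "AE z in M1 \<Otimes>\<^sub>M M2. P (fst z)"
proof (rule AE_distrD[OF measurable_fst])
  show "AE x in distr (M1 \<Otimes>\<^sub>M M2) M1 fst. P x"
    unfolding prob_space.distr_pair_fst[OF assms(1)] by (rule assms(2))
qed

lemma AE_pair_snd:
  assumes "prob_space M1" "prob_space M2" and P: "AE y in M2. P y"
  shows "AE z in M1 \<Otimes>\<^sub>M M2. P (snd z)"
proof -
  interpret M1: prob_space M1 by fact
  interpret M2: prob_space M2 by fact
  interpret pair_prob_space M1 M2 ..
  have "distr (M1 \<Otimes>\<^sub>M M2) M2 snd = M2"
  proof (rule measure_eqI)
    fix C assume "C \<in> sets (distr (M1 \<Otimes>\<^sub>M M2) M2 snd)"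
    then have C: "C \<in> sets M2" by simp
    have "snd -` C \<inter> space (M1 \<Otimes>\<^sub>M M2) = space M1 \<times> C"
      using sets.sets_into_space[OF C] by (auto simp: space_pair_measure)
    then show "emeasure (distr (M1 \<Otimes>\<^sub>M M2) M2 snd) C = emeasure M2 C"
      using C by (simp add: emeasure_distr M2.emeasure_pair_measure_Times M1.emeasure_space_1)
  qed simp
  with P show ?thesis by (intro AE_distrD[OF measurable_snd]) (simp only:)
qed

section \<open>Stationarity and contraction of the mean process\<close>

theorem proposition1:
  fixes \<mu> :: "real measure" and A h B :: "real \<Rightarrow> real" and \<Theta> E S :: "real set"
    and P Q :: "real \<Rightarrow> real measure" and g :: "real \<Rightarrow> real \<Rightarrow> real" and a b :: real
    and N :: "'b measure" and U :: "nat \<Rightarrow> 'b \<Rightarrow> real" and f :: "real \<Rightarrow> real \<Rightarrow> real"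
  assumes family: "exponential_family \<mu> A h B \<Theta>"
    and P_def: "P = ef_law \<mu> A h"
    and Q_def: "Q = mean_law \<mu> A h B \<Theta>"
    and f_def: "f = random_map Q g"
    and observations: "observation_space P \<Theta> E"
    and g_nonneg: "\<And>x y. 0 \<le> x \<Longrightarrow> y \<in> E \<Longrightarrow> 0 \<le> g x y"
    and S_nonempty: "S \<noteq> {}" and S_nonneg: "S \<subseteq> {0..}" and S_range: "S \<subseteq> B ` \<Theta>"
    and S_complete: "complete S"
    and S_invariant: "\<And>u x. 0 < u \<Longrightarrow> u < 1 \<Longrightarrow> x \<in> S \<Longrightarrow> f u x \<in> S"
    and ab: "0 \<le> a" "0 \<le> b" "a + b < 1"
    and lipschitz: "\<And>x x' y y'. 0 \<le> x \<Longrightarrow> 0 \<le> x' \<Longrightarrow> y \<in> E \<Longrightarrow> y' \<in> E \<Longrightarrow>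
           \<bar>g x y - g x' y'\<bar> \<le> a * \<bar>x - x'\<bar> + b * \<bar>y - y'\<bar>"
    and N: "prob_space N"
    and U_uniform: "\<And>t. 1 \<le> t \<Longrightarrow> distr N borel (U t) = uniform01"
    and U_indep: "prob_space.indep_vars N (\<lambda>_. borel) U {1..}"
  shows "\<exists>\<pi>.
     \<comment> \<open>(1) almost sure convergence of the backward process\<close>
     (\<exists>Z\<in>borel_measurable N.
        (\<forall>x\<in>S. AE \<omega> in N. (\<lambda>n. backward f (\<lambda>t. U t \<omega>) n x) \<longlonglongrightarrow> Z \<omega>) \<and>
        distr N borel Z = \<pi>) \<and>
     stationary_distribution (transition_kernel Q E g) S \<pi> \<and>
     \<comment> \<open>(2) geometric moment contraction, uniqueness, finite mean\<close>
     geometric_moment_contracting uniform01 f \<pi> \<and>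
     (\<forall>\<pi>'. stationary_distribution (transition_kernel Q E g) S \<pi>' \<longrightarrow> \<pi>' = \<pi>) \<and>
     integrable \<pi> (\<lambda>x. x) \<and>
     \<comment> \<open>(3) stationarity of the observations under a stationary start\<close>
     (\<forall>(M :: 'a measure) \<eta> Y. observation_driven_model P B \<Theta> g S M \<eta> Y \<longrightarrow>
        distr M borel (\<lambda>\<omega>. B (\<eta> 1 \<omega>)) = \<pi> \<longrightarrow> stationary_series M Y)"
proof -
  interpret observation_model \<mu> A h B \<Theta> E S g a b
    using family observations S_nonempty S_nonneg S_range S_complete S_invariant ab lipschitz
    unfolding observation_model_def observation_model_axioms_def P_def Q_def f_def by blast
  interpret N: prob_space N by (rule N)
  have U_law: "distr N (\<Pi>\<^sub>M t\<in>{1..n}. uniform01) (\<lambda>\<omega>. \<lambda>t\<in>{1..n}. U t \<omega>) = (\<Pi>\<^sub>M t\<in>{1..n}. uniform01)" for n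
    by (rule distr_iid_initial_segment[OF N prob_space_uniform01 _ U_uniform U_indep]) simp
  have "\<forall>t\<in>{1..}. U t \<in> N \<rightarrow>\<^sub>M borel"
    using U_indep unfolding N.indep_vars_def by (rule conjunct1)
  then have U_measurable: "U t \<in> N \<rightarrow>\<^sub>M borel" if "1 \<le> t" for t using that by simp
  then have U_measurable': "U t \<in> N \<rightarrow>\<^sub>M uniform01" if "1 \<le> t" for t using that by simp
  interpret driven: driven_contracting_maps uniform01 F S "a + b" N U
    by unfold_locales (rule U_measurable', assumption, rule U_law)
  obtain Z where Z: "Z \<in> borel_measurable N"
      "\<And>x. x \<in> S \<Longrightarrow> AE \<omega> in N. (\<lambda>n. backward F (\<lambda>t. U t \<omega>) n x) \<longlonglongrightarrow> Z \<omega>"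
      "AE \<omega> in N. Z \<omega> \<in> S" "integrable N Z"
  proof (rule driven.backward_limit_exists)
    fix Z assume "Z \<in> borel_measurable N"
      "\<And>x. x \<in> S \<Longrightarrow> AE \<omega> in N. (\<lambda>n. driven.Z n x \<omega>) \<longlonglongrightarrow> Z \<omega>"
      "AE \<omega> in N. Z \<omega> \<in> S" "integrable N Z"
    then show thesis by (rule that)
  qed
  define \<pi> where "\<pi> = distr N borel Z"
  have stat: "chain.stationary \<pi>"
    unfolding \<pi>_def by (rule driven.limit_law_stationary[OF Z(1-3)])
  then have \<pi>: "prob_space \<pi>" "sets \<pi> = sets borel" "AE x in \<pi>. x \<in> S"
    by (simp_all add: chain.stationary_def)
  have mean: "integrable \<pi> (\<lambda>x. x)"
    unfolding \<pi>_def by (rule integrable_distr_eq[OF Z(1), THEN iffD2]) (use Z(4) in simp_all)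
  \<comment> \<open>The driving variables lie in \<open>(0,1)\<close> almost surely, so the maps may be exchanged for \<open>F\<close> in all almost
    sure statements and integrals below.\<close>
  have f_F: "f u x = F u x" if "u \<in> {0<..<1}" "x \<in> S" for u x
    unfolding f_def Q_def using F_eq[OF that(2,1)] ..

  have limit: "AE \<omega> in N. (\<lambda>n. backward f (\<lambda>t. U t \<omega>) n x) \<longlonglongrightarrow> Z \<omega>" if x: "x \<in> S" for x
  proof -
    have "AE \<omega> in N. \<forall>t\<in>{1..}. U t \<omega> \<in> {0<..<1}"
    proof (subst AE_ball_countable)
      show "\<forall>t\<in>{1..}. AE \<omega> in N. U t \<omega> \<in> {0<..<1}"
      proof
        fix t :: nat assume "t \<in> {1..}"
        then have t: "1 \<le> t" by simp
        show "AE \<omega> in N. U t \<omega> \<in> {0<..<1}"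
          by (rule AE_distrD[OF U_measurable[OF t]]) (simp only: U_uniform[OF t] AE_uniform01)
      qed
    qed simp
    with Z(2)[OF x] show ?thesis
    proof eventually_elim
      case (elim \<omega>)
      have "backward f (\<lambda>t. U t \<omega>) n x = backward F (\<lambda>t. U t \<omega>) n x" for n
        by (rule backward_cong_on[OF _ x]) (use elim(2) in \<open>simp add: f_F F_in\<close>)
      then show ?case using elim(1) by simp
    qed
  qed

  have gmc: "geometric_moment_contracting uniform01 f \<pi>"
    unfolding geometric_moment_contracting_def
  proof (intro exI conjI allI)
    define D where "D = (\<Pi>\<^sub>M t\<in>{1::nat..}. uniform01)"
    interpret \<pi>: prob_space \<pi> by (rule \<pi>)
    interpret D: prob_space D unfolding D_def by (rule chain.W.P.prob_space_axioms)
    interpret \<pi>D: pair_prob_space \<pi> D ..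
    \<comment> \<open>The rate has to be positive, whereas \<open>a + b\<close> may be \<open>0\<close>: hence the midpoint of \<open>a + b\<close> and \<open>1\<close>.
      Adding \<open>1\<close> makes the positivity of the constant immediate.\<close>
    let ?K = "2 * (\<integral>x. \<bar>x\<bar> \<partial>\<pi>) + 1" and ?r = "(a + b + 1) / 2"
    show "(1::real) > 0" by simp
    show "0 < ?K" by (simp add: add_nonneg_pos)
    show "0 < ?r" "?r < 1" using ab by simp_all
    fix n
    have "AE \<theta> in D. \<forall>t\<in>{1..}. \<theta> t \<in> {0<..<1}"
    proof (subst AE_ball_countable)
      show "\<forall>t\<in>{1..}. AE \<theta> in D. \<theta> t \<in> {0<..<1}"
        unfolding D_def by (intro ballI AE_PiM_component prob_space_uniform01 AE_uniform01)
    qed simp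
    then have "AE z in \<pi> \<Otimes>\<^sub>M (\<pi> \<Otimes>\<^sub>M D). \<forall>t\<in>{1..}. snd (snd z) t \<in> {0<..<1}"
      by (intro AE_pair_snd \<pi>.prob_space_axioms D.prob_space_axioms \<pi>D.prob_space_axioms)
    moreover have "AE z in \<pi> \<Otimes>\<^sub>M (\<pi> \<Otimes>\<^sub>M D). fst z \<in> S"
      by (rule AE_pair_fst[OF \<pi>D.prob_space_axioms \<pi>(3)])
    moreover have "AE z in \<pi> \<Otimes>\<^sub>M (\<pi> \<Otimes>\<^sub>M D). fst (snd z) \<in> S"
      by (rule AE_pair_snd[OF \<pi>.prob_space_axioms \<pi>D.prob_space_axioms AE_pair_fst[OF D.prob_space_axioms \<pi>(3)]])
    ultimately have "AE z in \<pi> \<Otimes>\<^sub>M (\<pi> \<Otimes>\<^sub>M D).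
      (case z of (w, w', \<theta>) \<Rightarrow> ennreal (dist (forward f \<theta> n w) (forward f \<theta> n w') powr 1)) =
      (case z of (w, w', \<theta>) \<Rightarrow> ennreal \<bar>forward F \<theta> n w - forward F \<theta> n w'\<bar>)"
    proof eventually_elim
      case (elim z)
      have "forward f (snd (snd z)) n w = forward F (snd (snd z)) n w" if "w \<in> S" for w
        by (rule forward_cong_on[OF _ that, THEN conjunct1]) (use elim(1) in \<open>simp add: f_F F_in\<close>)
      then show ?case using elim(2,3) by (simp add: case_prod_unfold dist_real_def)
    qed
    then have "(\<integral>\<^sup>+(w, w', \<theta>). ennreal (dist (forward f \<theta> n w) (forward f \<theta> n w') powr 1) \<partial>(\<pi> \<Otimes>\<^sub>M (\<pi> \<Otimes>\<^sub>M D))) =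
        (\<integral>\<^sup>+(w, w', \<theta>). ennreal \<bar>forward F \<theta> n w - forward F \<theta> n w'\<bar> \<partial>(\<pi> \<Otimes>\<^sub>M (\<pi> \<Otimes>\<^sub>M D)))"
      by (rule nn_integral_cong_AE)
    also have "\<dots> \<le> ennreal (2 * (\<integral>x. \<bar>x\<bar> \<partial>\<pi>) * (a + b) ^ n)"
      unfolding D_def by (rule chain.stationary_pair_contraction[OF \<pi> mean])
    also have "\<dots> \<le> ennreal (?K * ?r ^ n)"
      using ab by (intro ennreal_leI mult_mono power_mono) simp_all
    finally show "(\<integral>\<^sup>+(w, w', \<theta>). ennreal (dist (forward f \<theta> n w) (forward f \<theta> n w') powr 1)
        \<partial>(\<pi> \<Otimes>\<^sub>M (\<pi> \<Otimes>\<^sub>M (\<Pi>\<^sub>M t\<in>{1::nat..}. uniform01)))) \<le> ennreal (?K * ?r ^ n)"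
      unfolding D_def .
  qed

  have series: "stationary_series M Y"
    if "observation_driven_model P B \<Theta> g S M \<eta> Y" "distr M borel (\<lambda>\<omega>. B (\<eta> 1 \<omega>)) = \<pi>"
    for M :: "'a measure" and \<eta> Y
  proof -
    interpret observation_process \<mu> A h B \<Theta> E S g a b M \<eta> Y
      using that(1) unfolding P_def by unfold_locales
    show ?thesis using stat that(2) by (rule stationary_observations)
  qed

  show ?thesis
  proof (intro exI[of _ \<pi>] conjI bexI[of _ Z] ballI allI impI)
    show "Z \<in> borel_measurable N" by (rule Z(1))
    show "AE \<omega> in N. (\<lambda>n. backward f (\<lambda>t. U t \<omega>) n x) \<longlonglongrightarrow> Z \<omega>" if "x \<in> S" for x
      using that by (rule limit)
    show "distr N borel Z = \<pi>" by (simp only: \<pi>_def)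
    show "stationary_distribution (transition_kernel Q E g) S \<pi>"
      unfolding Q_def stationary_distribution_iff by (rule stat)
    show "geometric_moment_contracting uniform01 f \<pi>" by (rule gmc)
    show "integrable \<pi> (\<lambda>x. x)" by (rule mean)
  next
    fix \<pi>' assume "stationary_distribution (transition_kernel Q E g) S \<pi>'"
    then have "chain.stationary \<pi>'" unfolding Q_def stationary_distribution_iff .
    from driven.stationary_unique[OF Z(1-3) this] show "\<pi>' = \<pi>" unfolding \<pi>_def .
  next
    fix M :: "'a measure" and \<eta> Y
    assume "observation_driven_model P B \<Theta> g S M \<eta> Y" "distr M borel (\<lambda>\<omega>. B (\<eta> 1 \<omega>)) = \<pi>"
    then show "stationary_series M Y" by (rule series)
  qed
qed

end
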